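(* Let $p$ and $\frac{p+1}{2}$ both be odd primes. Then $$4\,C_{\rm d}(p)-C_{\rm d}(p+1)=4\,C_{\rm u}(p)-C_{\rm u}(p+1).$$
   Context: All graphs are simple (no loops, no multiple edges or arcs). An undirected edge is identified with the pair of oppositely directed arcs, so undirected graphs are regarded as symmetric digraphs. A circulant of order $n$ is a digraph on the vertex set $\mathbb{Z}_n=\{0,1,\dots,n-1\}$ invariant under the cyclic permutation $v\mapsto v+1 \pmod n$. $C_{\rm d}(n)$ and $C_{\rm u}(n)$ are the numbers of isomorphism classes of, respectively, directed circulants (i.e. all circulant digraphs, including the undirected ones) and undirected circulants of order $n$. *)

theory Defs
  imports
    "HOL-Computational_Algebra.Primes"
    "Graph_Theory.Pair_Digraph"
    "Graph_Theory.Digraph_Isomorphism"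
begin

text \<open>
  The residues modulo \<open>n\<close> are represented by the naturals below \<open>n\<close>.  A \<open>pair_digraph\<close> is
  finite and has no loops; its arcs are ordered pairs, so there are no multiple arcs.
\<close>

definition circulant :: "nat \<Rightarrow> nat pair_pre_digraph \<Rightarrow> bool" where
  "circulant n G \<longleftrightarrow> pair_digraph G \<and> pverts G = {..<n} \<and>
     map_prod (\<lambda>v. (v + 1) mod n) (\<lambda>v. (v + 1) mod n) ` parcs G = parcs G"

definition directed_circulants :: "nat \<Rightarrow> nat pair_pre_digraph set" where
  "directed_circulants n = {G. circulant n G}"

definition undirected_circulants :: "nat \<Rightarrow> nat pair_pre_digraph set" where
  "undirected_circulants n = {G. circulant n G \<and> symmetric (with_proj G)}"

definition iso_rel :: "'a pair_pre_digraph set \<Rightarrow> 'a pair_pre_digraph rel" where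
  "iso_rel S = {(G, H). G \<in> S \<and> H \<in> S \<and> digraph_iso (with_proj G) (with_proj H)}"

definition C_d :: "nat \<Rightarrow> nat" where
  "C_d n = card (directed_circulants n // iso_rel (directed_circulants n))"

definition C_u :: "nat \<Rightarrow> nat" where
  "C_u n = card (undirected_circulants n // iso_rel (undirected_circulants n))"

text \<open>
  On digraphs whose arcs are pairs, the library's notion of isomorphism amounts to a bijection of
  the vertices that carries the arcs of one digraph onto those of the other.
\<close>

lemma digraph_iso_with_proj_iff:
  assumes "pair_wf_digraph G"
  shows "digraph_iso (with_proj G) (with_proj H) \<longleftrightarrow>
    (\<exists>f. bij_betw f (pverts G) (pverts H) \<and> map_prod f f ` parcs G = parcs H)"
proof
  assume "digraph_iso (with_proj G) (with_proj H)"
  then obtain h where h: "pre_digraph.digraph_isomorphism (with_proj G) h"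
    and eq: "with_proj H = app_iso h (with_proj G)"
    unfolding digraph_iso_def by blast
  have V: "pverts H = iso_verts h ` pverts G" and A: "parcs H = iso_arcs h ` parcs G"
    and ends: "iso_tail h = fst" "iso_head h = snd"
    using eq by (simp_all add: with_proj_def app_iso_def)
  have "iso_arcs h a = map_prod (iso_verts h) (iso_verts h) a" if "a \<in> parcs G" for a
    using h that ends by (auto simp: pre_digraph.digraph_isomorphism_def prod_eq_iff)
  hence "map_prod (iso_verts h) (iso_verts h) ` parcs G = parcs H"
    unfolding A by (intro image_cong) simp_all
  moreover have "bij_betw (iso_verts h) (pverts G) (pverts H)"
    using h V by (auto simp: pre_digraph.digraph_isomorphism_def bij_betw_def)
  ultimately show "\<exists>f. bij_betw f (pverts G) (pverts H) \<and> map_prod f f ` parcs G = parcs H"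
    by blast
next
  assume "\<exists>f. bij_betw f (pverts G) (pverts H) \<and> map_prod f f ` parcs G = parcs H"
  then obtain f where f: "bij_betw f (pverts G) (pverts H)" "map_prod f f ` parcs G = parcs H"
    by blast
  interpret pair_wf_digraph G by fact
  let ?h = "\<lparr> iso_verts = f, iso_arcs = map_prod f f, iso_head = snd, iso_tail = fst \<rparr>"
  have "parcs G \<subseteq> pverts G \<times> pverts G"
    using in_arcsD1 in_arcsD2 by auto
  moreover have "inj_on (map_prod f f) (pverts G \<times> pverts G)"
    using f(1) by (intro map_prod_inj_on) (simp_all add: bij_betw_def)
  ultimately have "inj_on (map_prod f f) (parcs G)"
    by (rule inj_on_subset[rotated])
  hence "pre_digraph.digraph_isomorphism (with_proj G) ?h"
    using f(1) wf_digraph by (auto simp: pre_digraph.digraph_isomorphism_def bij_betw_def)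
  moreover have "with_proj H = app_iso ?h (with_proj G)"
    using f by (simp add: with_proj_def app_iso_def bij_betw_def)
  ultimately show "digraph_iso (with_proj G) (with_proj H)"
    unfolding digraph_iso_def by blast
qed

lemma equiv_iso_rel:
  assumes "\<And>G. G \<in> S \<Longrightarrow> pair_wf_digraph G"
  shows "equiv S (iso_rel S)"
proof (rule equivI)
  show "iso_rel S \<subseteq> S \<times> S"
    by (auto simp: iso_rel_def)
  show "refl_on S (iso_rel S)"
  proof (rule refl_onI)
    fix G assume "G \<in> S"
    moreover have "bij_betw id (pverts G) (pverts G) \<and> map_prod id id ` parcs G = parcs G"
      by (simp add: prod.map_id0)
    hence "digraph_iso (with_proj G) (with_proj G)"
      using digraph_iso_with_proj_iff[OF assms[OF \<open>G \<in> S\<close>], of G] by blast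
    ultimately show "(G, G) \<in> iso_rel S"
      by (simp add: iso_rel_def)
  qed
  show "sym (iso_rel S)"
  proof (rule symI)
    fix G H assume GH: "(G, H) \<in> iso_rel S"
    then interpret pair_wf_digraph G
      using assms by (simp add: iso_rel_def)
    show "(H, G) \<in> iso_rel S"
      using GH digraph_iso_swap[OF wf_digraph] by (auto simp: iso_rel_def)
  qed
  show "trans (iso_rel S)"
    by (rule transI) (auto simp: iso_rel_def intro: digraph_iso_trans)
qed

lemma finite_directed_circulants: "finite (directed_circulants n)"
proof (rule finite_subset)
  show "directed_circulants n \<subseteq>
      (\<lambda>A. \<lparr> pverts = {..<n}, parcs = A \<rparr>) ` Pow ({..<n} \<times> {..<n})"
  proof
    fix G assume "G \<in> directed_circulants n"
    hence G: "pair_wf_digraph G" "pverts G = {..<n}"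
      by (auto simp: directed_circulants_def circulant_def
          pair_digraph_def pair_fin_digraph_def)
    hence "parcs G \<subseteq> {..<n} \<times> {..<n}"
      using pair_wf_digraph.in_arcsD1 pair_wf_digraph.in_arcsD2 by fastforce
    moreover have "G = \<lparr> pverts = {..<n}, parcs = parcs G \<rparr>"
      using G(2) by simp
    ultimately show "G \<in> (\<lambda>A. \<lparr> pverts = {..<n}, parcs = A \<rparr>) ` Pow ({..<n} \<times> {..<n})"
      by blast
  qed
qed simp

end

theory Submission
  imports Defs
    "HOL-Algebra.Sylow"
    "HOL-Combinatorics.Permutations"
    "HOL-Number_Theory.Residue_Primitive_Roots"
begin

text \<open>
  Isomorphic circulants of order \<open>p\<close>, or of order \<open>2q\<close> with \<open>q = (p + 1) / 2\<close>, differ only by a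
  multiplier, that is, by a unit of the ring of residues which carries one connection set onto
  the other (\<open>multiplier_prime\<close>, \<open>multiplier_twice_prime\<close>).  In both cases the units form a cyclic
  group.  Listing the nonzero residues modulo \<open>p\<close> as powers of a primitive root turns
  connection sets into binary sequences of period \<open>p - 1\<close>, and multiplication by a unit into a
  rotation.  Modulo \<open>2q\<close> the residues other than \<open>0\<close> and \<open>q\<close> fall into the orbits of \<open>1\<close> and of
  \<open>2\<close> under the units; interleaving these two orbits gives binary sequences of period
  \<open>2 (q - 1) = p - 1\<close> again, but now multiplication by a unit is a rotation by an even number of
  places.  The fixed residue \<open>q\<close> contributes a factor \<open>2\<close>.  A connection set is symmetric exactly
  if half of the period is a period too, because \<open>-1\<close> is the unit of order two.

  Hence, with \<open>M = q - 1\<close> and \<open>N\<^sub>d(L)\<close> the number of classes of \<open>L\<close>-periodic binary sequences under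
  rotations by multiples of \<open>d\<close>, the four numbers are \<open>N\<^sub>1(2M)\<close>, \<open>2 N\<^sub>2(2M)\<close>, \<open>N\<^sub>1(M)\<close> and \<open>2 N\<^sub>2(M)\<close>,
  and the claim is that \<open>2 N\<^sub>1(L) - N\<^sub>2(L)\<close> is the same for \<open>L = M\<close> and \<open>L = 2M\<close>.  For even \<open>L\<close> a
  class under all rotations splits into two classes under even rotations unless its members
  have an odd period, so this difference counts the classes with an odd period.  As \<open>M\<close> is
  even, a sequence with an odd period has period \<open>2M\<close> if and only if it has period \<open>M\<close>
  (\<open>necklaces_double\<close>).

  The multiplier theorems rest on the observation of Babai that an isomorphism yields a second
  regular cycle \<open>d\<close> in the automorphism group of the first circulant, next to the rotation \<open>c\<close>; it
  suffices to conjugate \<open>d\<close> into the powers of \<open>c\<close>.  A Sylow subgroup \<open>P\<close> contains conjugates of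
  both cycles (for order \<open>p\<close>), respectively of their squares (for order \<open>2q\<close>).  In the first case
  point stabilizers in \<open>P\<close> are trivial and \<open>P\<close> consists of powers of \<open>c\<close>.  In the second case this
  argument fails only if some group of automorphisms fixes a vertex and is transitive on the
  vertices of the other parity; then the arcs between the two parities are all present or all
  absent, and the problem reduces to circulants of order \<open>q\<close>.
\<close>

section \<open>Binary necklaces and rotations by an even number of places\<close>

definition periodic :: "nat \<Rightarrow> (nat \<Rightarrow> bool) set" where
  "periodic L = {f. \<forall>k. f (k + L) = f k}"

definition rotation :: "nat \<Rightarrow> (nat \<Rightarrow> bool) rel" where
  "rotation d = {(f, f'). \<exists>i. f' = (\<lambda>k. f (k + d * i))}"

definition necklaces :: "nat \<Rightarrow> nat \<Rightarrow> nat" where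
  "necklaces d L = card (periodic L // (rotation d \<inter> periodic L \<times> periodic L))"

lemma rotation_1_iff: "(f, g) \<in> rotation 1 \<longleftrightarrow> (\<exists>i. g = (\<lambda>k. f (k + i)))"
  by (simp add: rotation_def)

lemma rotation_2_iff: "(f, g) \<in> rotation 2 \<longleftrightarrow> (\<exists>i. g = (\<lambda>k. f (k + 2 * i)))"
  by (simp add: rotation_def)

lemma periodic_mult: "f \<in> periodic L \<Longrightarrow> f (k + L * m) = f k"
proof (induction m)
  case (Suc m)
  have "f (k + L * Suc m) = f ((k + L * m) + L)" by (simp add: algebra_simps)
  thus ?case using Suc by (simp add: periodic_def)
qed simp

lemma periodic_dvd: "f \<in> periodic L \<Longrightarrow> L dvd M \<Longrightarrow> f \<in> periodic M"
  using periodic_mult by (fastforce simp: periodic_def elim!: dvdE)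

lemma periodic_cong:
  assumes "f \<in> periodic L" "k mod L = l mod L"
  shows "f k = f l"
proof -
  have "f k = f (k mod L)" for k
    using periodic_mult[OF assms(1), of "k mod L" "k div L"] by (simp only: mod_mult_div_eq)
  thus ?thesis using assms(2) by metis
qed

lemma periodic_shift: "f \<in> periodic L \<Longrightarrow> (\<lambda>k. f (k + i)) \<in> periodic L"
proof -
  assume f: "f \<in> periodic L"
  have "f (k + L + i) = f (k + i)" for k
    using periodic_mult[OF f, of "k + i" 1] by (simp add: add_ac)
  thus ?thesis by (simp add: periodic_def)
qed

lemma finite_periodic: "L > 0 \<Longrightarrow> finite (periodic L)"
proof -
  assume "L > 0"
  have "inj_on (\<lambda>f. {k\<in>{..<L}. f k}) (periodic L)"
  proof (rule inj_onI, rule ext)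
    fix f g k assume fg: "f \<in> periodic L" "g \<in> periodic L" "{k\<in>{..<L}. f k} = {k\<in>{..<L}. g k}"
    have "k mod L \<in> {k\<in>{..<L}. f k} \<longleftrightarrow> k mod L \<in> {k\<in>{..<L}. g k}" by (simp only: fg(3))
    hence "f (k mod L) = g (k mod L)" using \<open>L > 0\<close> by simp
    moreover have "f k = f (k mod L)" by (rule periodic_cong[OF fg(1)]) simp
    moreover have "g k = g (k mod L)" by (rule periodic_cong[OF fg(2)]) simp
    ultimately show "f k = g k" by argo
  qed
  thus ?thesis
    by (rule inj_on_finite[where B = "Pow {..<L}"]) auto
qed

text \<open>
  Rotations are forward only; symmetry holds because a rotation by \<open>(L - 1) d i\<close> places undoes one by
  \<open>d i\<close> places on sequences of period \<open>L\<close>.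
\<close>

lemma equiv_rotation: "equiv Y (rotation d \<inter> Y \<times> Y)" if "Y \<subseteq> periodic L" "L > 0"
proof (rule equivI)
  show "refl_on Y (rotation d \<inter> Y \<times> Y)"
    by (auto simp: refl_on_def rotation_def intro!: exI[of _ 0])
  show "sym (rotation d \<inter> Y \<times> Y)"
  proof (rule symI)
    fix f g assume fg: "(f, g) \<in> rotation d \<inter> Y \<times> Y"
    then obtain i where g: "g = (\<lambda>k. f (k + d * i))" by (auto simp: rotation_def)
    have "f = (\<lambda>k. g (k + d * ((L - 1) * i)))"
    proof
      fix k
      have "d * ((L - 1) * i) + d * i = L * (d * i)"
        using that(2) by (cases L) (auto simp: algebra_simps)
      hence "g (k + d * ((L - 1) * i)) = f (k + L * (d * i))"
        by (simp add: g add.assoc)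
      also have "\<dots> = f k"
        using fg that by (intro periodic_mult) auto
      finally show "f k = g (k + d * ((L - 1) * i))" ..
    qed
    thus "(g, f) \<in> rotation d \<inter> Y \<times> Y"
      using fg by (auto simp: rotation_def)
  qed
  show "trans (rotation d \<inter> Y \<times> Y)"
  proof (rule transI)
    fix f g h assume "(f, g) \<in> rotation d \<inter> Y \<times> Y" "(g, h) \<in> rotation d \<inter> Y \<times> Y"
    moreover then obtain i j where "g = (\<lambda>k. f (k + d * i))" "h = (\<lambda>k. g (k + d * j))"
      by (auto simp: rotation_def)
    hence "h = (\<lambda>k. f (k + d * (j + i)))" by (simp add: algebra_simps)
    ultimately show "(f, h) \<in> rotation d \<inter> Y \<times> Y"
      unfolding rotation_def by blast
  qed
qed auto

lemma card_quotient_Un: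
  assumes "equiv (X \<union> Y) R" and "X \<inter> Y = {}" and "finite (X \<union> Y)" and "\<And>x y. (x, y) \<in> R \<Longrightarrow> x \<in> X \<Longrightarrow> y \<in> X"
  shows "card ((X \<union> Y) // R) = card (X // (R \<inter> X \<times> X)) + card (Y // (R \<inter> Y \<times> Y))"
proof -
  have RY: "y \<in> Y" if "(x, y) \<in> R" "x \<in> Y" for x y
  proof -
    have "(y, x) \<in> R" using that assms(1) by (meson equivE symE)
    moreover have "y \<in> X \<union> Y" using that assms(1) by (meson equiv_class_eq_iff)
    ultimately show ?thesis using assms(2,4) that by blast
  qed
  have "R `` {x} = (R \<inter> X \<times> X) `` {x}" if "x \<in> X" for x
    using that assms(4) by auto
  hence X: "X // R = X // (R \<inter> X \<times> X)"
    unfolding quotient_def by auto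
  have "R `` {x} = (R \<inter> Y \<times> Y) `` {x}" if "x \<in> Y" for x
    using that RY by auto
  hence Y: "Y // R = Y // (R \<inter> Y \<times> Y)"
    unfolding quotient_def by auto
  have "(X \<union> Y) // R = X // R \<union> Y // R" by (auto simp: quotient_def)
  moreover have "X // R \<inter> Y // R = {}"
  proof -
    have "C \<subseteq> X" "C \<noteq> {}" if "C \<in> X // R" for C
      using that assms(4) equiv_class_self[OF assms(1)] by (auto elim!: quotientE)
    moreover have "C \<subseteq> Y" if "C \<in> Y // R" for C
      using that RY by (auto elim!: quotientE)
    ultimately show ?thesis using assms(2) by blast
  qed
  moreover have "finite (X // R)" "finite (Y // R)"
    using assms(3) by (auto simp: quotient_def)
  ultimately show ?thesis using X Y by (simp add: card_Un_disjoint)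
qed

lemma necklaces_split:
  assumes "L > 0" and "\<And>f i. f \<in> X \<Longrightarrow> (\<lambda>k. f (k + i)) \<in> X" "X \<subseteq> periodic L"
  shows "necklaces d L = card (X // (rotation d \<inter> X \<times> X))
     + card ((periodic L - X) // (rotation d \<inter> (periodic L - X) \<times> (periodic L - X)))"
proof -
  have X: "X \<union> (periodic L - X) = periodic L" using assms by blast
  define R where "R = rotation d \<inter> (periodic L \<times> periodic L)"
  have "necklaces d L = card ((X \<union> (periodic L - X)) // R)"
    unfolding X necklaces_def R_def ..
  also have "\<dots> =
      card (X // (R \<inter> X \<times> X)) +
      card ((periodic L - X) // (R \<inter> (periodic L - X) \<times> (periodic L - X)))"
  proof (rule card_quotient_Un)
    show "equiv (X \<union> (periodic L - X)) R"
      unfolding X R_def by (rule equiv_rotation[OF _ assms(1)]) simp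
    show "finite (X \<union> (periodic L - X))"
      unfolding X by (rule finite_periodic[OF assms(1)])
    show "g \<in> X" if "(f, g) \<in> R" "f \<in> X" for f g
    proof -
      obtain i where "g = (\<lambda>k. f (k + d * i))"
        using \<open>(f, g) \<in> R\<close> unfolding R_def rotation_def by blast
      thus ?thesis using assms(2) \<open>f \<in> X\<close> by blast
    qed
  qed blast
  also have "R \<inter> X \<times> X = rotation d \<inter> X \<times> X"
    using assms(3) by (auto simp: R_def)
  also have "R \<inter> (periodic L - X) \<times> (periodic L - X)
      = rotation d \<inter> (periodic L - X) \<times> (periodic L - X)"
    using assms(3) by (auto simp: R_def)
  finally show ?thesis .
qed

text \<open>
  If \<open>s\<close> moves every point to a different \<open>Q\<close>-class of the same \<open>R\<close>-class, and these two \<open>Q\<close>-classes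
  exhaust it, then every \<open>R\<close>-class consists of exactly two \<open>Q\<close>-classes.
\<close>

lemma card_quotient_double:
  assumes R: "equiv X R" and Q: "equiv X Q" and fin: "finite X" and "Q \<subseteq> R"
    and s: "\<And>x. x \<in> X \<Longrightarrow> (x, s x) \<in> R - Q"
    and "\<And>x y. (x, y) \<in> R \<Longrightarrow> (x, y) \<in> Q \<or> (s x, y) \<in> Q"
  shows "card (X // Q) = 2 * card (X // R)"
proof -
  have cls: "C // Q = {Q `` {x}, Q `` {s x}}" if "x \<in> X" "C = R `` {x}" for C x
  proof -
    have "Q `` {y} \<in> {Q `` {x}, Q `` {s x}}" if "(x, y) \<in> R" for y
      using assms(6)[OF that] equiv_class_eq[OF Q] by fastforce
    moreover have "x \<in> C" "s x \<in> C"
      using that s equiv_class_self[OF R] by auto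
    ultimately show ?thesis using that(2) by (auto simp: quotient_def)
  qed
  have X: "X // Q = (\<Union>C\<in>X // R. C // Q)"
  proof -
    have "X // Q = (\<Union>x\<in>\<Union>(X // R). {Q `` {x}})"
      unfolding Union_quotient[OF R] by (simp add: quotient_def)
    also have "\<dots> = (\<Union>C\<in>X // R. C // Q)"
      by (auto simp: quotient_def[of _ Q])
    finally show ?thesis .
  qed
  have "card (X // Q) = (\<Sum>C\<in>X // R. card (C // Q))"
    unfolding X
  proof (rule card_UN_disjoint)
    show "finite (X // R)" using fin by (auto simp: quotient_def)
    show "\<forall>C\<in>X // R. finite (C // Q)"
      using cls by (metis finite.emptyI finite.insertI quotientE)
    have sub: "B \<subseteq> C \<and> B \<noteq> {}" if "C \<in> X // R" "B \<in> C // Q" for B C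
    proof -
      from that obtain x y where "x \<in> X" "C = R `` {x}" "y \<in> C" "B = Q `` {y}"
        by (auto simp: quotient_def)
      moreover have "y \<in> X" using calculation equiv_class_eq_iff[OF R] by blast
      moreover have "R `` {x} = R `` {y}"
        using calculation equiv_class_eq[OF R, of x y] by simp
      ultimately show ?thesis
        using \<open>Q \<subseteq> R\<close> equiv_class_self[OF Q, of y] by auto
    qed
    show "\<forall>C\<in>X // R. \<forall>D\<in>X // R. C \<noteq> D \<longrightarrow> C // Q \<inter> D // Q = {}"
    proof (intro ballI impI)
      fix C D assume CD: "C \<in> X // R" "D \<in> X // R" "C \<noteq> D"
      hence "C \<inter> D = {}" using quotient_disj[OF R] by blast
      thus "C // Q \<inter> D // Q = {}" using sub CD by blast
    qed
  qed
  also have "\<dots> = (\<Sum>C\<in>X // R. 2)"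
  proof (rule sum.cong)
    fix C assume "C \<in> X // R"
    then obtain x where "x \<in> X" "C = R `` {x}" by (auto elim!: quotientE)
    moreover have "Q `` {x} \<noteq> Q `` {s x}"
    proof
      assume "Q `` {x} = Q `` {s x}"
      moreover have "s x \<in> X" using s[OF \<open>x \<in> X\<close>] equiv_class_eq_iff[OF R] by blast
      ultimately show False
        using s[OF \<open>x \<in> X\<close>] eq_equiv_class[OF _ Q] by blast
    qed
    ultimately show "card (C // Q) = 2" using cls by simp
  qed simp
  finally show ?thesis by simp
qed

definition oddly_periodic :: "nat \<Rightarrow> (nat \<Rightarrow> bool) set" where
  "oddly_periodic L = {f\<in>periodic L. \<exists>t. odd t \<and> f \<in> periodic t}"

text \<open>
  If \<open>t = 2u + 1\<close> and \<open>2M\<close> are periods, then so is \<open>tM - 2Mu = M\<close>.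
\<close>

lemma oddly_periodic_double: "even M \<Longrightarrow> oddly_periodic (2 * M) = oddly_periodic M"
proof -
  have "f \<in> periodic M" if "f \<in> periodic (2 * M)" "odd t" "f \<in> periodic t" for f t
  proof -
    obtain u where "t = 2 * u + 1" using \<open>odd t\<close> by (elim oddE)
    hence u: "t * M = M + 2 * M * u" by simp
    have "f (k + M) = f k" for k
      using periodic_mult[OF that(1), of "k + M" u] periodic_mult[OF that(3), of k M] u
      by (simp add: add.assoc)
    thus ?thesis by (simp add: periodic_def)
  qed
  thus ?thesis
    using periodic_dvd[of _ M "2 * M"] by (auto simp: oddly_periodic_def)
qed

lemma rotation_2_subset: "rotation 2 \<subseteq> rotation 1"
  by (auto simp: rotation_def)

text \<open>
  Rotation by one place leaves the class under even rotations if and only if there is no odd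
  period: a coincidence of the shift by \<open>1\<close> with a shift by \<open>2i\<close> makes the odd number \<open>2i - 1\<close> a
  period, and conversely an odd period turns odd shifts into even ones.
\<close>

lemma two_necklaces:
  assumes "L > 0" and "even L"
  shows "2 * necklaces 1 L = necklaces 2 L +
    card (oddly_periodic L // (rotation 1 \<inter> oddly_periodic L \<times> oddly_periodic L))"
proof -
  define X where "X = oddly_periodic L"
  define Y where "Y = periodic L - X"
  have X: "X \<subseteq> periodic L" by (auto simp: X_def oddly_periodic_def)
  have shX: "\<And>f i. f \<in> X \<Longrightarrow> (\<lambda>k. f (k + i)) \<in> X"
    using periodic_shift unfolding X_def oddly_periodic_def by blast
  have "rotation 1 \<inter> X \<times> X = rotation 2 \<inter> X \<times> X"
  proof -
    have "(f, g) \<in> rotation 2" if fg: "(f, g) \<in> rotation 1" "f \<in> X" for f g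
    proof -
      obtain t where t: "odd t" "f \<in> periodic t"
        using \<open>f \<in> X\<close> unfolding X_def oddly_periodic_def by blast
      obtain i where i: "g = (\<lambda>k. f (k + i))"
        using fg(1) unfolding rotation_1_iff by (rule exE)
      have "even (i + t * i)" using t by simp
      then obtain j where j: "i + t * i = 2 * j" by (elim evenE)
      have "f (k + i) = f (k + 2 * j)" for k
        using periodic_mult[OF t(2), of "k + i" i] by (simp add: add.assoc j)
      hence "g = (\<lambda>k. f (k + 2 * j))" using i by (intro ext) simp
      thus ?thesis unfolding rotation_2_iff by (rule exI)
    qed
    thus ?thesis using rotation_2_subset by blast
  qed
  moreover have "card (Y // (rotation 2 \<inter> Y \<times> Y)) = 2 * card (Y // (rotation 1 \<inter> Y \<times> Y))"
  proof (rule card_quotient_double)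
    show "equiv Y (rotation 1 \<inter> Y \<times> Y)" "equiv Y (rotation 2 \<inter> Y \<times> Y)"
      using \<open>L > 0\<close> by (auto intro!: equiv_rotation simp: Y_def)
    show "finite Y" using finite_periodic[OF \<open>L > 0\<close>] by (simp add: Y_def)
    show "rotation 2 \<inter> Y \<times> Y \<subseteq> rotation 1 \<inter> Y \<times> Y" using rotation_2_subset by blast
    have shY: "(\<lambda>k. f (k + i)) \<in> Y" if "f \<in> Y" for f i
    proof -
      have f: "f \<in> periodic L" "f \<notin> X" using that by (simp_all add: Y_def)
      have "(\<lambda>k. f (k + i)) \<notin> X"
      proof
        assume "(\<lambda>k. f (k + i)) \<in> X"
        from shX[OF this, of "(L - 1) * i"]
        have "(\<lambda>k. f (k + (L - 1) * i + i)) \<in> X" .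
        moreover have "(L - 1) * i + i = L * i" using \<open>L > 0\<close> by (cases L) auto
        moreover have "f (k + L * i) = f k" for k
          by (rule periodic_mult[OF f(1)])
        ultimately have "f \<in> X" by (simp only: add.assoc)
        thus False using f(2) by blast
      qed
      thus ?thesis using periodic_shift[OF f(1)] unfolding Y_def by blast
    qed
    show "(f, (\<lambda>k. f (k + 1))) \<in> rotation 1 \<inter> Y \<times> Y - rotation 2 \<inter> Y \<times> Y" if "f \<in> Y" for f
    proof -
      have "(f, (\<lambda>k. f (k + 1))) \<notin> rotation 2"
      proof
        assume "(f, (\<lambda>k. f (k + 1))) \<in> rotation 2"
        then obtain i where "(\<lambda>k. f (k + 1)) = (\<lambda>k. f (k + 2 * i))"
          unfolding rotation_2_iff by (rule exE)
        hence i: "f (k + 1) = f (k + 2 * i)" for k by (rule fun_cong)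
        \<comment> \<open>the period wanted is \<open>2i - 1\<close>; adding the even number \<open>L\<close> covers the case \<open>i = 0\<close>\<close>
        have per: "f (k + (2 * i + (L - 1))) = f k" for k
        proof -
          have "f (k + (2 * i + (L - 1))) = f ((k + (L - 1)) + 1)"
            unfolding i by (simp add: algebra_simps)
          also have "\<dots> = f (k + L)" using \<open>L > 0\<close> by simp
          also have "\<dots> = f k" using that by (auto simp: Y_def periodic_def)
          finally show ?thesis .
        qed
        hence "f \<in> periodic (2 * i + (L - 1))" by (simp add: periodic_def)
        moreover have "odd (2 * i + (L - 1))" using assms by simp
        moreover have f: "f \<in> periodic L" "f \<notin> X" using that by (simp_all add: Y_def)
        ultimately show False unfolding X_def oddly_periodic_def by blast
      qed
      moreover have "(f, (\<lambda>k. f (k + 1))) \<in> rotation 1"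
        unfolding rotation_1_iff by (rule exI) (rule refl)
      moreover have "(\<lambda>k. f (k + 1)) \<in> Y" by (rule shY[OF that])
      ultimately show ?thesis using that by blast
    qed
    show "(f, g) \<in> rotation 2 \<inter> Y \<times> Y \<or> ((\<lambda>k. f (k + 1)), g) \<in> rotation 2 \<inter> Y \<times> Y"
      if fg: "(f, g) \<in> rotation 1 \<inter> Y \<times> Y" for f g
    proof -
      obtain i where i: "g = (\<lambda>k. f (k + i))"
        using IntD1[OF fg] unfolding rotation_1_iff by (rule exE)
      show ?thesis
      proof (cases "even i")
        case True
        then obtain j where "i = 2 * j" by (elim evenE)
        hence "(f, g) \<in> rotation 2" unfolding rotation_2_iff using i by (intro exI) simp
        thus ?thesis using that by blast
      next
        case False
        then obtain j where "i = 2 * j + 1" by (elim oddE)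
        hence "g = (\<lambda>k. (\<lambda>k. f (k + 1)) (k + 2 * j))" using i by (simp add: algebra_simps)
        hence "((\<lambda>k. f (k + 1)), g) \<in> rotation 2" unfolding rotation_2_iff by (rule exI)
        moreover have "(\<lambda>k. f (k + 1)) \<in> Y" using that shY by blast
        ultimately show ?thesis using that by blast
      qed
    qed
  qed
  ultimately show ?thesis
    using necklaces_split[OF \<open>L > 0\<close> shX X, of 1] necklaces_split[OF \<open>L > 0\<close> shX X, of 2]
    unfolding X_def[symmetric] Y_def by simp
qed

theorem necklaces_double:
  assumes "M > 0" and "even M"
  shows "2 * necklaces 1 (2 * M) + necklaces 2 M = 2 * necklaces 1 M + necklaces 2 (2 * M)"
  using two_necklaces[of M] two_necklaces[of "2 * M"] oddly_periodic_double[of M] assms by simp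

section \<open>Sylow subgroups absorb elements of prime order\<close>

text \<open>
  Without fixed points all orbits of \<open>f\<close> would have exactly \<open>q\<close> elements.
\<close>

lemma fixed_point_prime_period:
  assumes "finite X" and "f ` X \<subseteq> X" and "\<And>x. x \<in> X \<Longrightarrow> (f ^^ q) x = x"
    and "prime q" and "\<not> q dvd card X"
  shows "\<exists>x\<in>X. f x = x"
proof (rule ccontr)
  assume nofix: "\<not> (\<exists>x\<in>X. f x = x)"
  have q0: "q > 0" using \<open>prime q\<close> prime_gt_0_nat by blast
  have X: "(f ^^ i) x \<in> X" if "x \<in> X" for i x
    using that assms(2) by (induction i) auto
  have per: "(f ^^ (d * i)) x = x" if "(f ^^ d) x = x" for d i x
    using that by (induction i) (simp_all add: funpow_add)
  have fmod: "(f ^^ (i mod q)) x = (f ^^ i) x" if "x \<in> X" for i x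
    using funpow_mod_eq[of q f x i] assms(3)[OF that] by blast
  have inj: "inj_on (\<lambda>i. (f ^^ i) x) {..<q}" if "x \<in> X" for x
  proof (rule linorder_inj_onI)
    fix i j assume ij: "i < j" "i \<in> {..<q}" "j \<in> {..<q}"
    show "(f ^^ i) x \<noteq> (f ^^ j) x"
    proof
      assume eq: "(f ^^ i) x = (f ^^ j) x"
      define y where "y = (f ^^ i) x"
      have "(f ^^ j) x = (f ^^ (j - i)) y"
        using ij(1) unfolding y_def by (metis add_diff_inverse_nat comp_apply funpow_add less_imp_not_less add.commute)
      hence d: "(f ^^ (j - i)) y = y" using eq y_def by simp
      have yX: "y \<in> X" using X that y_def by simp
      have "\<not> q dvd j - i" using ij by (simp add: nat_dvd_not_less)
      hence "coprime (j - i) q" using \<open>prime q\<close> by (metis coprime_commute prime_imp_coprime)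
      then obtain a where "[(j - i) * a = 1] (mod q)" using cong_solve_coprime_nat by auto
      hence "(j - i) * a mod q = 1"
        using prime_gt_1_nat[OF \<open>prime q\<close>] by (simp add: cong_def)
      hence "(f ^^ 1) y = y" using fmod[OF yX, of "(j - i) * a"] per[OF d, of a] by simp
      thus False using nofix yX by simp
    qed
  qed auto
  define R where "R = {(x, y). x \<in> X \<and> (\<exists>i. y = (f ^^ i) x)}"
  have cls: "R `` {x} = (\<lambda>i. (f ^^ i) x) ` {..<q}" if "x \<in> X" for x
  proof -
    have "\<exists>i<q. (f ^^ j) x = (f ^^ i) x" for j
      using fmod[OF that, of j] q0 by (metis mod_less_divisor)
    thus ?thesis using that unfolding R_def by auto
  qed
  have "equiv X R"
  proof (rule equivI)
    show "R \<subseteq> X \<times> X" using X by (auto simp: R_def)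
    show "refl_on X R" by (auto simp: refl_on_def R_def intro: exI[of _ 0])
    show "trans R"
    proof (rule transI)
      fix x y z assume "(x, y) \<in> R" "(y, z) \<in> R"
      then obtain i j where "x \<in> X" "y = (f ^^ i) x" "z = (f ^^ j) y" by (auto simp: R_def)
      hence "z = (f ^^ (j + i)) x" by (simp add: funpow_add)
      thus "(x, z) \<in> R" using \<open>x \<in> X\<close> unfolding R_def by blast
    qed
    show "sym R"
    proof (rule symI)
      fix x y assume "(x, y) \<in> R"
      then obtain i where i: "x \<in> X" "y = (f ^^ i) x" by (auto simp: R_def)
      have "(f ^^ ((q - 1) * i)) y = (f ^^ ((q - 1) * i + i)) x" by (simp add: i funpow_add)
      also have "(q - 1) * i + i = q * i" using q0 by (cases q) auto
      also have "(f ^^ (q * i)) x = x" by (rule per[OF assms(3)[OF i(1)]])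
      finally show "(y, x) \<in> R" using X[OF i(1), of i] i(2) unfolding R_def by fastforce
    qed
  qed
  moreover have "q dvd card C" if "C \<in> X // R" for C
    using that cls inj by (auto elim!: quotientE simp: card_image)
  ultimately have "q dvd card X" by (rule equiv_imp_dvd_card[OF \<open>finite X\<close>])
  thus False using assms(5) by simp
qed

text \<open>
  An element \<open>r\<close> of order \<open>q\<close> permutes the cosets of a Sylow subgroup \<open>P\<close>, whose number is prime to
  \<open>q\<close>; a fixed coset \<open>P g\<close> means that \<open>g r g\<^sup>-\<^sup>1\<close> lies in \<open>P\<close>.
\<close>

lemma (in group) sylow_absorbing:
  assumes "finite (carrier G)" and "prime q"
  obtains P a where "subgroup P G" and "card P = q ^ a"
    and "\<And>r. r \<in> carrier G \<Longrightarrow> r [^] q = \<one> \<Longrightarrow> \<exists>g\<in>carrier G. g \<otimes> r \<otimes> inv g \<in> P"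
proof -
  have "order G \<noteq> 0" using assms(1) order_gt_0_iff_finite by simp
  then obtain a m where am: "order G = q ^ a * m" "\<not> q dvd m"
    using multiplicity_decompose'[of "order G" q] \<open>prime q\<close>
    by (metis not_prime_unit)
  then obtain P where P: "subgroup P G" "card P = q ^ a"
    using sylow_thm[of q G a m] assms is_group by auto
  have "\<exists>g\<in>carrier G. g \<otimes> r \<otimes> inv g \<in> P" if r: "r \<in> carrier G" "r [^] q = \<one>" for r
  proof -
    have "q ^ a * card (rcosets P) = q ^ a * m"
      using lagrange[OF P(1)] P(2) am(1) by (simp add: mult.commute)
    hence "card (rcosets P) = m" using \<open>prime q\<close> prime_gt_0_nat by simp
    moreover have sub: "P \<subseteq> carrier G" using P(1) subgroup.subset by blast
    have pow: "((\<lambda>C. C #> r) ^^ i) C = C #> (r [^] i)" if "C \<in> rcosets P" for C i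
    proof (induction i)
      case 0
      thus ?case using rcosets_subset_PowG[OF P(1)] that by (auto simp: coset_mult_one)
    next
      case (Suc i)
      thus ?case using rcosets_subset_PowG[OF P(1)] that r(1)
        by (auto simp: coset_mult_assoc)
    qed
    have "\<exists>C\<in>rcosets P. C #> r = C"
    proof (rule fixed_point_prime_period[OF _ _ _ \<open>prime q\<close>])
      show "finite (rcosets P)" using rcosets_subset_PowG[OF P(1)] assms(1)
        by (meson finite_Pow_iff finite_subset)
      show "(\<lambda>C. C #> r) ` (rcosets P) \<subseteq> rcosets P"
        using r(1) sub by (auto simp: RCOSETS_def coset_mult_assoc)
      show "((\<lambda>C. C #> r) ^^ q) C = C" if "C \<in> rcosets P" for C
        using pow[OF that, of q] r(2) rcosets_subset_PowG[OF P(1)] that by (auto simp: coset_mult_one)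
      show "\<not> q dvd card (rcosets P)" using \<open>card (rcosets P) = m\<close> am(2) by simp
    qed
    then obtain g where g: "g \<in> carrier G" "P #> g #> r = P #> g"
      by (auto simp: RCOSETS_def)
    have "g \<otimes> r \<in> P #> g #> r"
      using g(1) r(1) rcos_self[OF g(1) P(1)] unfolding r_coset_def by blast
    then obtain h where "h \<in> P" "g \<otimes> r = h \<otimes> g"
      unfolding g(2) by (auto simp: r_coset_def)
    hence "g \<otimes> r \<otimes> inv g = h" using g(1) sub by (simp add: m_assoc subset_eq)
    thus ?thesis using \<open>h \<in> P\<close> g(1) by auto
  qed
  thus ?thesis using that P by blast
qed

section \<open>Permutation groups of prime power order\<close>

text \<open>
  Groups of permutations as plain sets of functions; the existence of a left inverse in the set is
  all that the arguments below need of inverses.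
\<close>

definition perm_group :: "'a set \<Rightarrow> ('a \<Rightarrow> 'a) set \<Rightarrow> bool" where
  "perm_group V P \<longleftrightarrow> (\<forall>e\<in>P. e permutes V) \<and> id \<in> P \<and> (\<forall>e\<in>P. \<forall>e'\<in>P. e \<circ> e' \<in> P) \<and>
     (\<forall>e\<in>P. \<exists>e'\<in>P. e' \<circ> e = id)"

lemma perm_groupD:
  assumes "perm_group V P"
  shows "e \<in> P \<Longrightarrow> e permutes V" and "id \<in> P" and "e \<in> P \<Longrightarrow> e' \<in> P \<Longrightarrow> e \<circ> e' \<in> P"
    and "e \<in> P \<Longrightarrow> \<exists>e'\<in>P. e' \<circ> e = id"
  using assms by (auto simp: perm_group_def)

lemma perm_group_funpow: "perm_group V P \<Longrightarrow> e \<in> P \<Longrightarrow> e ^^ i \<in> P"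
  by (induction i) (auto dest: perm_groupD)

lemma perm_group_stabilizer:
  assumes "perm_group V P"
  shows "perm_group V {e\<in>P. e x = x}"
  unfolding perm_group_def
proof (intro conjI ballI)
  fix e assume "e \<in> {e\<in>P. e x = x}"
  moreover then obtain e' where "e' \<in> P" "e' \<circ> e = id" using perm_groupD(4)[OF assms] by blast
  ultimately show "\<exists>e'\<in>{e\<in>P. e x = x}. e' \<circ> e = id"
    by (metis (mono_tags, lifting) comp_apply id_apply mem_Collect_eq)
qed (use perm_groupD[OF assms] in auto)

lemma orbit_stabilizer:
  assumes "perm_group V P" and "finite P"
  shows "card P = card ((\<lambda>e. e x) ` P) * card {e\<in>P. e x = x}"
proof -
  have "card {e\<in>P. e x = y} = card {e\<in>P. e x = x}" if "y \<in> (\<lambda>e. e x) ` P" for y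
  proof -
    obtain g where g: "g \<in> P" "g x = y" using \<open>y \<in> (\<lambda>e. e x) ` P\<close> by blast
    then obtain g' where g': "g' \<in> P" "g' \<circ> g = id" using perm_groupD(4)[OF assms(1)] by blast
    have g'g: "g' (g z) = z" for z using g'(2) by (metis comp_apply id_apply)
    have "inj g'" using perm_groupD(1)[OF assms(1) g'(1)] permutes_inj by blast
    hence gg': "g (g' z) = z" for z using g'g by (metis injD)
    have "bij_betw ((\<circ>) g) {e\<in>P. e x = x} {e\<in>P. e x = y}"
    proof (rule bij_betw_byWitness[where f' = "(\<circ>) g'"])
      show "\<forall>a\<in>{e \<in> P. e x = x}. g' \<circ> (g \<circ> a) = a" "\<forall>a\<in>{e \<in> P. e x = y}. g \<circ> (g' \<circ> a) = a"
        by (auto simp: fun_eq_iff g'g gg')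
      show "(\<circ>) g ` {e \<in> P. e x = x} \<subseteq> {e \<in> P. e x = y}"
        "(\<circ>) g' ` {e \<in> P. e x = y} \<subseteq> {e \<in> P. e x = x}"
        using g g' g'g perm_groupD(3)[OF assms(1)] by auto
    qed
    thus ?thesis by (simp add: bij_betw_same_card)
  qed
  moreover have "card P = (\<Sum>y\<in>(\<lambda>e. e x) ` P. card {e\<in>P. e x = y})"
    using sum.image_gen[OF assms(2), of "\<lambda>_. 1::nat" "\<lambda>e. e x"] by simp
  ultimately show ?thesis by simp
qed

definition q_group :: "nat \<Rightarrow> 'a set \<Rightarrow> ('a \<Rightarrow> 'a) set \<Rightarrow> bool" where
  "q_group q V P \<longleftrightarrow> prime q \<and> perm_group V P \<and> (\<exists>a. card P = q ^ a)"

lemma q_group_orbit_stabilizer: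
  assumes "q_group q V P"
  shows "\<exists>b. card ((\<lambda>e. e x) ` P) = q ^ b" and "q_group q V {e\<in>P. e x = x}"
proof -
  obtain a where a: "prime q" "perm_group V P" "card P = q ^ a"
    using assms by (auto simp: q_group_def)
  hence "finite P" by (metis card.infinite power_not_zero not_prime_0)
  hence "q ^ a = card ((\<lambda>e. e x) ` P) * card {e\<in>P. e x = x}"
    using orbit_stabilizer[OF a(2)] a(3) by simp
  hence "card ((\<lambda>e. e x) ` P) dvd q ^ a" "card {e\<in>P. e x = x} dvd q ^ a" by simp_all
  thus "\<exists>b. card ((\<lambda>e. e x) ` P) = q ^ b" "q_group q V {e\<in>P. e x = x}"
    using a perm_group_stabilizer[OF a(2)] divides_primepow_nat[OF a(1)]
    unfolding q_group_def by blast+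
qed

lemma q_group_small_orbit:
  assumes "q_group q V P" and "\<And>e. e \<in> P \<Longrightarrow> e x \<in> W" and "finite W" and "card W < q" and "e \<in> P"
  shows "e x = x"
proof -
  obtain b where b: "card ((\<lambda>e. e x) ` P) = q ^ b" using q_group_orbit_stabilizer(1)[OF assms(1)] by blast
  have "card ((\<lambda>e. e x) ` P) \<le> card W" using assms by (intro card_mono) auto
  hence "q ^ b < q ^ 1" using b assms(4) by simp
  moreover have "1 < q" using prime_gt_1_nat[of q] assms(1) by (simp add: q_group_def)
  ultimately have "b < 1" by (rule power_less_imp_less_exp[rotated])
  hence "b = 0" by simp
  hence "card ((\<lambda>e. e x) ` P) = 1" using b by simp
  then obtain y where "(\<lambda>e. e x) ` P = {y}" by (auto simp: card_1_singleton_iff)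
  moreover have "id \<in> P" using assms(1) perm_groupD(2) by (auto simp: q_group_def)
  ultimately have "e x = y" "id x = y" using assms(5) by blast+
  thus ?thesis by simp
qed

text \<open>
  The stabilizer of \<open>x\<close> acts on the remaining \<open>q - 1\<close> points of the orbit, and its orbits there have
  prime power size below \<open>q\<close>, hence size one.
\<close>

lemma q_group_stabilizer_fixes:
  assumes "q_group q V P" and "card Orb = q" and "\<And>e z. e \<in> P \<Longrightarrow> z \<in> Orb \<Longrightarrow> e z \<in> Orb"
    and "x \<in> Orb" "y \<in> Orb" "e \<in> P" "e x = x"
  shows "e y = y"
proof (cases "y = x")
  case False
  have q: "q > 0" using assms(1) prime_gt_0_nat by (auto simp: q_group_def)
  show ?thesis
  proof (rule q_group_small_orbit[OF q_group_orbit_stabilizer(2)[OF assms(1), of x]])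
    show "f y \<in> Orb - {x}" if "f \<in> {e\<in>P. e x = x}" for f
    proof -
      have f: "f \<in> P" "f x = x" using that by simp_all
      have "perm_group V P" using assms(1) by (simp add: q_group_def)
      hence "inj f" using perm_groupD(1) f(1) permutes_inj by blast
      hence "f y \<noteq> x" using f(2) False injD[of f y x] by metis
      thus ?thesis using assms(3)[OF f(1) assms(5)] by blast
    qed
    show "finite (Orb - {x})" "card (Orb - {x}) < q"
      using assms(2,4) q by (auto intro: card_ge_0_finite)
    show "e \<in> {e\<in>P. e x = x}" using assms by simp
  qed
qed (use assms in simp)

section \<open>Two regular cycles in one group of prime power order\<close>

text \<open>
  The cycles of full length on \<open>V\<close>, described by their powers: these generate a regular cyclic
  group.
\<close>

definition regular_cycle :: "'a set \<Rightarrow> ('a \<Rightarrow> 'a) \<Rightarrow> bool" where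
  "regular_cycle V c \<longleftrightarrow> c permutes V \<and> c ^^ card V = id \<and> (\<forall>x\<in>V. \<forall>y\<in>V. \<exists>i. (c ^^ i) x = y)"

lemma funpow_in:
  assumes "c permutes V" and "x \<in> V"
  shows "(c ^^ i) x \<in> V"
  using assms by (induction i) (auto simp: permutes_in_image)

lemma regular_cycle_mod:
  assumes "regular_cycle V c"
  shows "(c ^^ (i mod card V)) x = (c ^^ i) x"
  using funpow_mod_eq[of "card V" c x i] assms by (simp add: regular_cycle_def)

lemma regular_cycle_image:
  assumes "regular_cycle V c" and "finite V" and "x \<in> V"
  shows "(\<lambda>i. (c ^^ i) x) ` {..<card V} = V" and "inj_on (\<lambda>i. (c ^^ i) x) {..<card V}"
proof -
  have c: "c permutes V" using assms(1) by (simp add: regular_cycle_def)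
  have "y \<in> (\<lambda>i. (c ^^ i) x) ` {..<card V}" if "y \<in> V" for y
  proof -
    obtain i where "(c ^^ i) x = y" using assms \<open>y \<in> V\<close> unfolding regular_cycle_def by blast
    moreover have "card V > 0" using assms card_gt_0_iff by blast
    ultimately show ?thesis using regular_cycle_mod[OF assms(1), of i x]
      by (intro image_eqI[of _ _ "i mod card V"]) auto
  qed
  thus img: "(\<lambda>i. (c ^^ i) x) ` {..<card V} = V" using funpow_in[OF c assms(3)] by blast
  show "inj_on (\<lambda>i. (c ^^ i) x) {..<card V}"
    by (rule eq_card_imp_inj_on) (simp_all add: img)
qed

lemma regular_cycle_inverse:
  assumes "regular_cycle V c" and "V \<noteq> {}" "finite V"
  shows "c ^^ ((card V - 1) * m) \<circ> c ^^ m = id" and "c ^^ m \<circ> c ^^ ((card V - 1) * m) = id"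
proof -
  have m: "(card V - 1) * m + m = card V * m" using assms(2,3) by (cases "card V") auto
  have "c ^^ (card V * m) = (c ^^ card V) ^^ m" by (simp add: funpow_mult)
  also have "\<dots> = id" using assms(1) by (simp add: regular_cycle_def)
  finally have "c ^^ (card V * m) = id" .
  thus "c ^^ ((card V - 1) * m) \<circ> c ^^ m = id" "c ^^ m \<circ> c ^^ ((card V - 1) * m) = id"
    using m funpow_add[of "(card V - 1) * m" m c] funpow_add[of m "(card V - 1) * m" c]
    by (simp_all add: add.commute)
qed

lemma perm_group_eqI:
  assumes "perm_group V P" and "e \<in> P" "f \<in> P" "e x = f x"
    and "\<And>g. g \<in> P \<Longrightarrow> g x = x \<Longrightarrow> g = id"
  shows "e = f"
proof -
  obtain f' where f': "f' \<in> P" "f' \<circ> f = id" using perm_groupD(4)[OF assms(1,3)] by blast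
  have "(f' \<circ> e) x = x" using assms(4) f'(2) by (metis comp_apply id_apply)
  hence "f' \<circ> e = id" using assms(5) perm_groupD(3)[OF assms(1) f'(1) assms(2)] by blast
  moreover have "inj f'" using perm_groupD(1)[OF assms(1) f'(1)] permutes_inj by blast
  ultimately show ?thesis using f'(2) by (metis fun.inj_map_strong injD)
qed

text \<open>
  Here \<open>V\<close> itself is an orbit of prime size, so stabilizers in \<open>P\<close> are trivial and \<open>d\<close> equals the power
  of \<open>c\<close> that agrees with it at one point.
\<close>

lemma cycles_in_q_group_prime:
  assumes "finite V" and "card V = p" and "q_group p V P"
    and "regular_cycle V c" "c \<in> P" and "d \<in> P"
  shows "\<exists>m. d = c ^^ m"
proof -
  have P: "prime p" "perm_group V P" using assms(3) by (auto simp: q_group_def)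
  then obtain x where x: "x \<in> V" using assms(2) by fastforce
  have stab: "g = id" if g: "g \<in> P" "g x = x" for g
  proof
    fix y
    have "g permutes V" using perm_groupD(1)[OF P(2) g(1)] .
    moreover have "g y = y" if "y \<in> V"
      by (rule q_group_stabilizer_fixes[OF assms(3,2) _ x that g])
        (use perm_groupD(1)[OF P(2)] in \<open>auto simp: permutes_in_image\<close>)
    ultimately show "g y = id y" by (auto simp: permutes_def)
  qed
  have "d x \<in> V" using perm_groupD(1)[OF P(2) assms(6)] x by (simp add: permutes_in_image)
  then obtain m where "(c ^^ m) x = d x" using assms(4) x unfolding regular_cycle_def by blast
  hence "d = c ^^ m"
    using perm_group_eqI[OF P(2) assms(6) perm_group_funpow[OF P(2) assms(5)]] stab by metis
  thus ?thesis by blast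
qed

definition aut :: "'a set \<Rightarrow> ('a \<times> 'a) set \<Rightarrow> ('a \<Rightarrow> 'a) set" where
  "aut V A = {f. f permutes V \<and> (\<forall>x y. (f x, f y) \<in> A \<longleftrightarrow> (x, y) \<in> A)}"

lemma aut_perm_group: "perm_group V (aut V A)"
  unfolding perm_group_def
proof (intro conjI ballI)
  fix e assume e: "e \<in> aut V A"
  let ?i = "inv_into UNIV e"
  have p: "e permutes V" using e by (simp add: aut_def)
  have "(?i x, ?i y) \<in> A \<longleftrightarrow> (x, y) \<in> A" for x y
  proof -
    have "(e (?i x), e (?i y)) \<in> A \<longleftrightarrow> (?i x, ?i y) \<in> A" using e by (simp add: aut_def)
    thus ?thesis by (simp add: permutes_inverses(1)[OF p])
  qed
  hence "?i \<in> aut V A" using permutes_inv[OF p] by (simp add: aut_def)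
  thus "\<exists>e'\<in>aut V A. e' \<circ> e = id" using permutes_inv_o(2)[OF p] by blast
next
  fix e e' assume "e \<in> aut V A" "e' \<in> aut V A"
  thus "e \<circ> e' \<in> aut V A" by (simp add: aut_def permutes_compose)
qed (simp_all add: aut_def permutes_id)

text \<open>
  The degenerate case for even order: from each vertex either all arcs to the vertices reached by
  odd powers of \<open>c\<close> are present, or none of them.
\<close>

definition halves_uniform :: "'a set \<Rightarrow> ('a \<times> 'a) set \<Rightarrow> ('a \<Rightarrow> 'a) \<Rightarrow> bool" where
  "halves_uniform V A c \<longleftrightarrow>
     (\<forall>x\<in>V. \<forall>i j. odd i \<longrightarrow> odd j \<longrightarrow> (x, (c ^^ i) x) \<in> A \<longleftrightarrow> (x, (c ^^ j) x) \<in> A)"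

lemma half_orbit:
  assumes "finite V" and "card V = 2 * q" and "regular_cycle V c" and "x \<in> V"
  defines "H \<equiv> (\<lambda>y. (\<lambda>i. (c ^^ (2 * i)) y) ` {..<q})"
  shows "card (H x) = q" and "even i \<Longrightarrow> (c ^^ i) x \<in> H x" and "odd i \<Longrightarrow> (c ^^ i) x \<in> H (c x)"
    and "H x \<union> H (c x) = V" and "H x \<inter> H (c x) = {}"
proof -
  have q: "q > 0" using assms(1,2,4) card_gt_0_iff by fastforce
  have c: "c permutes V" using assms(3) by (simp add: regular_cycle_def)
  have inj: "inj_on (\<lambda>i. (c ^^ i) x) {..<2 * q}" using regular_cycle_image(2)[OF assms(3,1,4)] assms(2) by simp
  have cx: "(c ^^ (2 * i)) (c x) = (c ^^ (2 * i + 1)) x" for i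
    by (simp add: funpow_swap1)
  show ev: "(c ^^ i) x \<in> H x" if i: "even i" for i
  proof -
    have "even (i mod (2 * q))" using i by (simp add: dvd_mod_iff)
    then obtain j where "i mod (2 * q) = 2 * j" by (elim evenE)
    moreover have "i mod (2 * q) < 2 * q" using q by simp
    ultimately show ?thesis using regular_cycle_mod[OF assms(3), of i x] assms(2)
      unfolding H_def by (intro image_eqI[of _ _ j]) auto
  qed
  show od: "(c ^^ i) x \<in> H (c x)" if i: "odd i" for i
  proof -
    have "odd (i mod (2 * q))" using i by (simp add: dvd_mod_iff)
    then obtain j where "i mod (2 * q) = 2 * j + 1" by (elim oddE)
    moreover have "i mod (2 * q) < 2 * q" using q by simp
    ultimately show ?thesis using regular_cycle_mod[OF assms(3), of i x] assms(2)
      unfolding H_def by (intro image_eqI[of _ _ j]) (auto simp: funpow_swap1)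
  qed
  have "inj_on (\<lambda>i. (c ^^ (2 * i)) x) {..<q}"
  proof (rule inj_onI)
    fix i j assume "i \<in> {..<q}" "j \<in> {..<q}" "(c ^^ (2 * i)) x = (c ^^ (2 * j)) x"
    thus "i = j" using inj_onD[OF inj, of "2 * i" "2 * j"] by simp
  qed
  thus "card (H x) = q" unfolding H_def by (simp add: card_image)
  have "H x \<subseteq> V" "H (c x) \<subseteq> V"
    unfolding H_def using funpow_in[OF c] assms(4) permutes_in_image[OF c] by auto
  moreover have "V \<subseteq> H x \<union> H (c x)"
  proof
    fix y assume "y \<in> V"
    then obtain i where "y = (c ^^ i) x" using assms(3,4) unfolding regular_cycle_def by metis
    thus "y \<in> H x \<union> H (c x)" using ev[of i] od[of i] by (cases "even i") auto
  qed
  ultimately show "H x \<union> H (c x) = V" by blast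
  show "H x \<inter> H (c x) = {}"
  proof (rule ccontr)
    assume "H x \<inter> H (c x) \<noteq> {}"
    then obtain i j where ij: "i < q" "j < q" "(c ^^ (2 * i)) x = (c ^^ (2 * j)) (c x)"
      unfolding H_def by auto
    hence "(c ^^ (2 * i)) x = (c ^^ (2 * j + 1)) x" using cx by simp
    hence "2 * i = 2 * j + 1" using inj_onD[OF inj, of "2 * i" "2 * j + 1"] ij by auto
    thus False by presburger
  qed
qed

text \<open>
  Orbits of \<open>P\<close> have prime power size between \<open>q\<close> and \<open>2q < q\<^sup>2\<close>, hence size \<open>q\<close>; this is where \<open>q\<close>
  must be odd.
\<close>

lemma q_group_orbit_eq_half:
  assumes "finite V" and "card V = 2 * q" and "odd q" and "q_group q V P"
    and "regular_cycle V c" "c ^^ 2 \<in> P" and "x \<in> V"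
  shows "(\<lambda>e. e x) ` P = (\<lambda>i. (c ^^ (2 * i)) x) ` {..<q}"
proof -
  have P: "prime q" "perm_group V P" using assms(4) by (auto simp: q_group_def)
  have "q > 2" using P(1) assms(3) prime_ge_2_nat[of q] by (cases "q = 2") auto
  have sub: "(\<lambda>e. e x) ` P \<subseteq> V" using perm_groupD(1)[OF P(2)] assms(7) by (auto simp: permutes_in_image)
  have H: "(\<lambda>i. (c ^^ (2 * i)) x) ` {..<q} \<subseteq> (\<lambda>e. e x) ` P"
    using perm_group_funpow[OF P(2) assms(6)] by (auto simp: funpow_mult)
  have fin: "finite ((\<lambda>e. e x) ` P)" by (rule finite_subset[OF sub assms(1)])
  have "card ((\<lambda>e. e x) ` P) = q"
  proof -
    obtain b where b: "card ((\<lambda>e. e x) ` P) = q ^ b" using q_group_orbit_stabilizer(1)[OF assms(4)] by blast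
    have "q ^ b \<le> 2 * q" using card_mono[OF assms(1) sub] assms(2) b by simp
    also have "\<dots> < q ^ 2" using \<open>q > 2\<close> by (simp add: power2_eq_square)
    finally have "b < 2" using \<open>q > 2\<close> power_less_imp_less_exp[of q b 2] by simp
    moreover have "q \<le> q ^ b"
      using card_mono[OF fin H] b half_orbit(1)[OF assms(1,2,5,7)] by simp
    hence "b \<noteq> 0" using \<open>q > 2\<close> by (cases b) auto
    ultimately have "b = 1" by simp
    thus ?thesis using b by simp
  qed
  thus ?thesis
    using half_orbit(1)[OF assms(1,2,5,7)] card_subset_eq[OF fin H] by simp
qed

text \<open>
  Unless the arcs between the two halves are uniform, no group of automorphisms fixes a vertex
  \<open>x\<close> and is transitive on the half not containing \<open>x\<close>.  This makes stabilizers in \<open>P\<close> trivial, so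
  that \<open>c\<^sup>2\<close> is a power of \<open>d\<^sup>2\<close> and \<open>d\<close> commutes with \<open>c\<^sup>2\<close>.  If \<open>c\<^sup>m\<close> is the power that
  agrees with \<open>d\<close> at \<open>x\<close>, then \<open>z = c\<^sup>-\<^sup>m d\<close> fixes the half of \<open>x\<close> pointwise and commutes with \<open>c\<^sup>2\<close>, so on
  the other half it is either the identity, which gives \<open>d = c\<^sup>m\<close>, or a cycle of length \<open>q\<close>, which is
  excluded.
\<close>

lemma cycles_in_q_group_twice_prime:
  assumes V: "finite V" "card V = 2 * q" and "odd q" and P: "q_group q V P" "P \<subseteq> aut V A"
    and c: "regular_cycle V c" "c ^^ 2 \<in> P" "c \<in> aut V A"
    and d: "regular_cycle V d" "d ^^ 2 \<in> P" "d \<in> aut V A"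
  shows "(\<exists>m. d = c ^^ m) \<or> halves_uniform V A c"
proof (rule disjCI)
  assume nuni: "\<not> halves_uniform V A c"
  have q: "prime q" and pg: "perm_group V P" using P(1) by (auto simp: q_group_def)
  note orbc = q_group_orbit_eq_half[OF V \<open>odd q\<close> P(1) c(1,2)]
  note orbd = q_group_orbit_eq_half[OF V \<open>odd q\<close> P(1) d(1,2)]
  note half = half_orbit[OF V c(1)]
  have cp: "c permutes V" and dp: "d permutes V"
    using c(1) d(1) by (auto simp: regular_cycle_def)
  obtain x where x: "x \<in> V" and
    nx: "\<And>y. \<exists>i. odd i \<and> \<not> ((x, (c ^^ i) x) \<in> A \<longleftrightarrow> (x, y) \<in> A)"
  proof -
    obtain x i j where "x \<in> V" "odd i" "odd j" "\<not> ((x, (c ^^ i) x) \<in> A \<longleftrightarrow> (x, (c ^^ j) x) \<in> A)"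
      using nuni unfolding halves_uniform_def by blast
    thus ?thesis using that by metis
  qed
  have cx: "c x \<in> V" using x cp by (simp add: permutes_in_image)
  let ?O = "\<lambda>y. (\<lambda>e. e y) ` P"
  have inO: "y \<in> ?O y" for y using perm_groupD(2)[OF pg] by (auto intro: image_eqI[of _ _ id])
  have card_O: "card (?O y) = q" if "y \<in> V" for y
    using half(1)[OF that] orbc[OF that] by simp
  have closed_O: "e z \<in> ?O y" if "e \<in> P" "z \<in> ?O y" for e y z
  proof -
    obtain f where "f \<in> P" "z = f y" using \<open>z \<in> ?O y\<close> by blast
    thus ?thesis using perm_groupD(3)[OF pg \<open>e \<in> P\<close>, of f] by (auto intro: image_eqI[of _ _ "e \<circ> f"])
  qed
  have UnO: "?O x \<union> ?O (c x) = V" and IntO: "?O x \<inter> ?O (c x) = {}"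
    using half(4,5)[OF x] orbc x cx by simp_all
  have oddO: "(c ^^ i) x \<in> ?O (c x)" if "odd i" for i
    using half(3)[OF x that] orbc[OF cx] by simp
  \<comment> \<open>otherwise the arcs from \<open>x\<close> into the other half would be uniform\<close>
  have not_trans: "\<exists>w\<in>?O (c x). \<forall>e\<in>aut V A. e x = x \<longrightarrow> e y \<noteq> w" for y
  proof (rule ccontr)
    assume "\<not> ?thesis"
    hence "(x, w) \<in> A \<longleftrightarrow> (x, y) \<in> A" if "w \<in> ?O (c x)" for w
      using that unfolding aut_def by (metis (mono_tags, lifting) mem_Collect_eq)
    thus False using nx[of y] oddO by blast
  qed
  have stab: "u = id" if u: "u \<in> P" "u x = x" for u
  proof (rule ccontr)
    assume "u \<noteq> id"
    then obtain z where z: "u z \<noteq> z" by (auto simp: fun_eq_iff)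
    have "z \<in> V" using z perm_groupD(1)[OF pg u(1)] unfolding permutes_def by blast
    have "u y = y" if "y \<in> ?O x" for y
      by (rule q_group_stabilizer_fixes[OF P(1) card_O[OF x], of x y u])
        (fact closed_O, fact inO, fact that, fact u(1), fact u(2))
    hence zO: "z \<in> ?O (c x)" using z \<open>z \<in> V\<close> UnO by blast
    let ?S = "{e\<in>P. e x = x}"
    have sub: "(\<lambda>e. e z) ` ?S \<subseteq> ?O (c x)" using closed_O[OF _ zO] by auto
    have "(\<lambda>e. e z) ` ?S \<noteq> ?O (c x)"
    proof
      assume eq: "(\<lambda>e. e z) ` ?S = ?O (c x)"
      obtain w where "w \<in> ?O (c x)" and w: "\<forall>e\<in>aut V A. e x = x \<longrightarrow> e z \<noteq> w"
        using not_trans[of z] by blast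
      hence "w \<in> (\<lambda>e. e z) ` ?S" using eq by simp
      thus False using w P(2) by blast
    qed
    moreover have "finite (?O (c x))" using UnO V(1) by (metis finite_Un)
    ultimately have "card ((\<lambda>e. e z) ` ?S) < q"
      using sub psubset_card_mono[of "?O (c x)" "(\<lambda>e. e z) ` ?S"] card_O[OF cx] by auto
    hence "u z = z"
      by (intro q_group_small_orbit[OF q_group_orbit_stabilizer(2)[OF P(1), of x],
            where W = "(\<lambda>e. e z) ` ?S"]) (use u finite_subset[OF sub \<open>finite (?O (c x))\<close>] in auto)
    thus False using z by simp
  qed
  \<comment> \<open>some power of \<open>d\<^sup>2\<close> agrees with \<open>c\<^sup>2\<close> at \<open>x\<close>, and the stabilizer of \<open>x\<close> is trivial\<close>
  obtain l where l: "c ^^ 2 = d ^^ (2 * l)"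
  proof -
    have "(c ^^ 2) x \<in> ?O x" using c(2) by blast
    then obtain l where "(c ^^ 2) x = (d ^^ (2 * l)) x" using orbd[OF x] by auto
    moreover have "d ^^ (2 * l) \<in> P" using perm_group_funpow[OF pg d(2), of l] by (simp add: funpow_mult)
    ultimately have "c ^^ 2 = d ^^ (2 * l)" using perm_group_eqI[OF pg c(2)] stab by blast
    thus ?thesis using that by blast
  qed
  have dc: "d ((c ^^ (2 * i)) y) = (c ^^ (2 * i)) (d y)" for i y
  proof -
    have "c ^^ (2 * i) = d ^^ (2 * l * i)" using l by (metis funpow_mult)
    thus ?thesis by (simp add: funpow_swap1)
  qed
  have dx: "d x \<notin> ?O x"
  proof
    assume "d x \<in> ?O x"
    have "d z \<in> ?O x" if "z \<in> ?O x" for z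
    proof -
      obtain i where "z = (c ^^ (2 * i)) x" using \<open>z \<in> ?O x\<close> orbc[OF x] by auto
      moreover have "c ^^ (2 * i) \<in> P" using perm_group_funpow[OF pg c(2), of i] by (simp add: funpow_mult)
      ultimately show ?thesis using dc closed_O[OF _ \<open>d x \<in> ?O x\<close>] by simp
    qed
    hence di: "(d ^^ i) x \<in> ?O x" for i using inO[of x] by (induction i) auto
    have "V \<subseteq> ?O x"
    proof
      fix y assume "y \<in> V"
      then obtain i where "(d ^^ i) x = y" using d(1) x unfolding regular_cycle_def by blast
      thus "y \<in> ?O x" using di[of i] by simp
    qed
    moreover have "c x \<notin> ?O x" using inO[of "c x"] IntO by blast
    ultimately show False using cx by blast
  qed
  obtain m where m: "(c ^^ m) x = d x" using c(1) x permutes_in_image[OF dp] unfolding regular_cycle_def by blast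
  define e where "e = c ^^ ((card V - 1) * m)"
  have e: "e \<circ> c ^^ m = id" "c ^^ m \<circ> e = id" "e \<in> aut V A"
    using regular_cycle_inverse[OF c(1) _ V(1), of m] x perm_group_funpow[OF aut_perm_group c(3)]
    by (auto simp: e_def)
  define z where "z = e \<circ> d"
  have zc: "z ((c ^^ (2 * i)) y) = (c ^^ (2 * i)) (z y)" for i y
    unfolding z_def e_def comp_apply dc by (metis add.commute comp_apply funpow_add)
  have zA: "z ^^ t \<in> aut V A" for t
    using perm_groupD(3)[OF aut_perm_group e(3) d(3)] perm_group_funpow[OF aut_perm_group] by (auto simp: z_def)
  have zp: "z permutes V" using zA[of 1] by (simp add: aut_def)
  have zx: "z x = x" using e(1) m unfolding z_def by (metis comp_apply id_apply)
  have zfix: "z y = y" if "y \<in> ?O x" for y using that zc zx orbc[OF x] by auto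
  show "\<exists>m. d = c ^^ m"
  proof (cases "z = id")
    case True
    hence "c ^^ m \<circ> (e \<circ> d) = c ^^ m" by (simp add: z_def)
    hence "d = c ^^ m" using e(2) by (metis comp_assoc id_comp)
    thus ?thesis by blast
  next
    case False
    then obtain y where y: "z y \<noteq> y" by (auto simp: fun_eq_iff)
    have "y \<in> V" using y zp unfolding permutes_def by blast
    hence yO: "y \<in> ?O (c x)" using y zfix UnO by blast
    have "z y \<notin> ?O x" using zfix[of "z y"] y permutes_inj[OF zp] by (auto dest: injD)
    hence "z y \<in> ?O (c x)" using UnO permutes_in_image[OF zp] \<open>y \<in> V\<close> by blast
    have Oy: "?O y = ?O (c x)"
    proof (rule card_subset_eq)
      show "finite (?O (c x))" using UnO V(1) by (metis finite_Un)
      show "?O y \<subseteq> ?O (c x)" using closed_O[OF _ yO] by blast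
      show "card (?O y) = card (?O (c x))" using card_O cx \<open>y \<in> V\<close> by simp
    qed
    then obtain s where s: "s < q" "z y = (c ^^ (2 * s)) y"
      using \<open>z y \<in> ?O (c x)\<close> orbc[OF \<open>y \<in> V\<close>] by auto
    have zt: "(z ^^ t) y = (c ^^ (2 * (s * t))) y" for t
    proof (induction t)
      case (Suc t)
      have "(z ^^ Suc t) y = (c ^^ (2 * (s * t))) (z y)" using Suc zc by simp
      also have "\<dots> = (c ^^ (2 * (s * t) + 2 * s)) y" by (simp only: s(2) funpow_add comp_apply)
      also have "2 * (s * t) + 2 * s = 2 * (s * Suc t)" by simp
      finally show ?case .
    qed simp
    have "s \<noteq> 0" using s(2) y by (metis funpow_0 mult_0_right)
    hence "coprime s q" using s(1) q by (metis coprime_commute nat_dvd_not_less neq0_conv prime_imp_coprime)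
    then obtain s' where s': "[s * s' = 1] (mod q)" using cong_solve_coprime_nat by auto
    have zxt: "(z ^^ t) x = x" for t by (induction t) (simp_all add: zx)
    have "\<exists>e\<in>aut V A. e x = x \<and> e y = w" if w: "w \<in> ?O (c x)" for w
    proof -
      obtain i where i: "i < q" "w = (c ^^ (2 * i)) y"
        using w Oy orbc[OF \<open>y \<in> V\<close>] by auto
      have "[s * (s' * i) = i] (mod q)" using cong_scalar_right[OF s', of i] by (simp add: mult.assoc)
      hence "(2 * (s * (s' * i))) mod (2 * q) = (2 * i) mod (2 * q)"
        by (simp add: cong_def mult_mod_right[symmetric])
      hence "(z ^^ (s' * i)) y = w"
        using regular_cycle_mod[OF c(1), of "2 * (s * (s' * i))" y]
          regular_cycle_mod[OF c(1), of "2 * i" y] zt[of "s' * i"] i(2) V(2) by simp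
      thus ?thesis using zA zxt by blast
    qed
    thus ?thesis using not_trans[of y] by metis
  qed
qed

section \<open>Conjugacy of regular cycles of automorphisms\<close>

text \<open>
  The absorbing Sylow subgroup, translated from abstract groups to sets of permutations.
\<close>

lemma aut_sylow:
  fixes V :: "'a set"
  assumes "finite V" and "prime q"
  obtains P where "q_group q V P" and "P \<subseteq> aut V A"
    and "\<And>r. r \<in> aut V A \<Longrightarrow> r ^^ q = id \<Longrightarrow>
      \<exists>g\<in>aut V A. \<exists>g'\<in>aut V A. g' \<circ> g = id \<and> g \<circ> g' = id \<and> g \<circ> r \<circ> g' \<in> P"
proof -
  define G :: "('a \<Rightarrow> 'a) monoid" where "G = \<lparr>carrier = aut V A, monoid.mult = (\<circ>), one = id\<rparr>"
  have G: "carrier G = aut V A" "monoid.mult G = (\<circ>)" "one G = id" by (simp_all add: G_def)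
  note pg = perm_groupD[OF aut_perm_group[of V A]]
  interpret group G
    by (rule groupI) (simp_all add: G pg comp_assoc)
  have "finite (carrier G)"
  proof (rule finite_subset)
    show "carrier G \<subseteq> {p. p permutes V}" using pg(1) by (auto simp: G)
    show "finite {p. p permutes V}" using finite_permutations[OF assms(1)] .
  qed
  then obtain P a where P: "subgroup P G" "card P = q ^ a"
    and absorb: "\<And>r. r \<in> carrier G \<Longrightarrow> r [^]\<^bsub>G\<^esub> q = \<one>\<^bsub>G\<^esub> \<Longrightarrow> \<exists>g\<in>carrier G. g \<otimes>\<^bsub>G\<^esub> r \<otimes>\<^bsub>G\<^esub> inv\<^bsub>G\<^esub> g \<in> P"
    using sylow_absorbing[OF _ assms(2)] by blast
  have sub: "P \<subseteq> aut V A" using subgroup.subset[OF P(1)] by (simp add: G)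
  have "perm_group V P"
    unfolding perm_group_def
  proof (intro conjI ballI)
    show "id \<in> P" using subgroup.one_closed[OF P(1)] by (simp add: G)
    show "e permutes V" if "e \<in> P" for e using that sub pg(1) by blast
    show "e \<circ> e' \<in> P" if "e \<in> P" "e' \<in> P" for e e'
      using subgroup.m_closed[OF P(1) that] by (simp add: G)
    show "\<exists>e'\<in>P. e' \<circ> e = id" if "e \<in> P" for e
      using subgroup.m_inv_closed[OF P(1) that] l_inv[of e] that sub by (auto simp: G)
  qed
  hence "q_group q V P" using P(2) assms(2) by (auto simp: q_group_def)
  moreover have "\<exists>g\<in>aut V A. \<exists>g'\<in>aut V A. g' \<circ> g = id \<and> g \<circ> g' = id \<and> g \<circ> r \<circ> g' \<in> P"
    if r: "r \<in> aut V A" "r ^^ q = id" for r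
  proof -
    have "r [^]\<^bsub>G\<^esub> i = r ^^ i" for i :: nat
      by (induction i) (simp_all add: G funpow_Suc_right del: funpow.simps(2))
    then obtain g where "g \<in> carrier G" "g \<otimes>\<^bsub>G\<^esub> r \<otimes>\<^bsub>G\<^esub> inv\<^bsub>G\<^esub> g \<in> P" using absorb[of r] r by (auto simp: G)
    thus ?thesis using inv_closed[of g] l_inv[of g] r_inv[of g] unfolding G by blast
  qed
  ultimately show ?thesis using that sub by blast
qed

lemma conj_funpow:
  assumes "g' \<circ> g = id"
  shows "g \<circ> g' = id \<Longrightarrow> (g \<circ> c \<circ> g') ^^ i = g \<circ> c ^^ i \<circ> g'"
proof (induction i)
  case (Suc i)
  have "g' (g x) = x" for x using assms by (metis comp_apply id_apply)
  thus ?case using Suc by (simp add: fun_eq_iff)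
qed simp

lemma regular_cycle_conj:
  assumes "regular_cycle V c" and "g permutes V" "g' permutes V" and g: "g' \<circ> g = id" "g \<circ> g' = id"
  shows "regular_cycle V (g \<circ> c \<circ> g')"
  unfolding regular_cycle_def
proof (intro conjI ballI)
  show "g \<circ> c \<circ> g' permutes V"
    using assms by (simp add: regular_cycle_def permutes_compose)
  show "(g \<circ> c \<circ> g') ^^ card V = id"
    using assms(1) g by (simp add: conj_funpow regular_cycle_def)
  fix x y assume "x \<in> V" "y \<in> V"
  hence "g' x \<in> V" "g' y \<in> V" using assms(3) by (simp_all add: permutes_in_image)
  then obtain i where "(c ^^ i) (g' x) = g' y" using assms(1) unfolding regular_cycle_def by blast
  hence "((g \<circ> c \<circ> g') ^^ i) x = g (g' y)" using g by (simp add: conj_funpow)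
  also have "\<dots> = y" using g(2) by (metis comp_apply id_apply)
  finally show "\<exists>i. ((g \<circ> c \<circ> g') ^^ i) x = y" by blast
qed

text \<open>
  If conjugates of \<open>d\<close> and of \<open>c\<close> are related by a power, then so are \<open>d\<close> and \<open>c\<close> up to a single
  conjugation by \<open>k\<^sup>-\<^sup>1 g\<close>.
\<close>

lemma conjugate_power:
  assumes "k' \<circ> k = id" and "g \<circ> d \<circ> g' = (k \<circ> c \<circ> k') ^^ m" and "k \<circ> k' = id" and "g' \<circ> g = id"
  shows "(k' \<circ> g) \<circ> d = c ^^ m \<circ> (k' \<circ> g)"
proof
  fix x
  have k: "k' (k y) = y" for y using assms(1) by (metis comp_apply id_apply)
  have g: "g' (g y) = y" for y using assms(4) by (metis comp_apply id_apply)
  have "g (d (g' (g x))) = k ((c ^^ m) (k' (g x)))"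
    using assms(2) unfolding conj_funpow[OF assms(1,3)] by (metis comp_apply)
  thus "((k' \<circ> g) \<circ> d) x = (c ^^ m \<circ> (k' \<circ> g)) x" by (simp add: g k)
qed

lemma regular_cycles_conjugate_prime:
  assumes "finite V" and "card V = p" and "prime p"
    and "regular_cycle V c" "c \<in> aut V A" and "regular_cycle V d" "d \<in> aut V A"
  shows "\<exists>h\<in>aut V A. \<exists>m. h \<circ> d = c ^^ m \<circ> h"
proof -
  note pg = perm_groupD[OF aut_perm_group[of V A]]
  obtain P where P: "q_group p V P" "P \<subseteq> aut V A"
    and absorb: "\<And>r. r \<in> aut V A \<Longrightarrow> r ^^ p = id \<Longrightarrow>
      \<exists>g\<in>aut V A. \<exists>g'\<in>aut V A. g' \<circ> g = id \<and> g \<circ> g' = id \<and> g \<circ> r \<circ> g' \<in> P"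
    using aut_sylow[OF assms(1,3), of A] by blast
  obtain k k' where k: "k \<in> aut V A" "k' \<in> aut V A" "k' \<circ> k = id" "k \<circ> k' = id" "k \<circ> c \<circ> k' \<in> P"
    using absorb[OF assms(5)] assms(2,4) unfolding regular_cycle_def by blast
  obtain g g' where g: "g \<in> aut V A" "g' \<in> aut V A" "g' \<circ> g = id" "g \<circ> g' = id" "g \<circ> d \<circ> g' \<in> P"
    using absorb[OF assms(7)] assms(2,6) unfolding regular_cycle_def by blast
  obtain m where "g \<circ> d \<circ> g' = (k \<circ> c \<circ> k') ^^ m"
    using cycles_in_q_group_prime[OF assms(1,2) P(1) regular_cycle_conj[OF assms(4)] k(5) g(5)] pg(1) k by blast
  thus ?thesis using conjugate_power[OF k(3) _ k(4) g(3)] pg(3)[OF k(2) g(1)] by blast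
qed

lemma regular_cycles_conjugate_twice_prime:
  assumes "finite V" and "card V = 2 * q" and "prime q" and "odd q"
    and "regular_cycle V c" "c \<in> aut V A" and "regular_cycle V d" "d \<in> aut V A"
  shows "(\<exists>h\<in>aut V A. \<exists>m. h \<circ> d = c ^^ m \<circ> h) \<or> halves_uniform V A c"
proof -
  note pg = perm_groupD[OF aut_perm_group[of V A]]
  obtain P where P: "q_group q V P" "P \<subseteq> aut V A"
    and absorb: "\<And>r. r \<in> aut V A \<Longrightarrow> r ^^ q = id \<Longrightarrow>
      \<exists>g\<in>aut V A. \<exists>g'\<in>aut V A. g' \<circ> g = id \<and> g \<circ> g' = id \<and> g \<circ> r \<circ> g' \<in> P"
    using aut_sylow[OF assms(1,3), of A] by blast
  have sq: "r ^^ 2 \<in> aut V A" "(r ^^ 2) ^^ q = id" if "regular_cycle V r" "r \<in> aut V A" for r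
    using that perm_group_funpow[OF aut_perm_group, of r V A 2] assms(2)
    by (simp_all add: regular_cycle_def funpow_mult)
  obtain k k' where k: "k \<in> aut V A" "k' \<in> aut V A" "k' \<circ> k = id" "k \<circ> k' = id" "k \<circ> c ^^ 2 \<circ> k' \<in> P"
    using absorb[OF sq[OF assms(5,6)]] by blast
  obtain g g' where g: "g \<in> aut V A" "g' \<in> aut V A" "g' \<circ> g = id" "g \<circ> g' = id" "g \<circ> d ^^ 2 \<circ> g' \<in> P"
    using absorb[OF sq[OF assms(7,8)]] by blast
  have "(\<exists>m. g \<circ> d \<circ> g' = (k \<circ> c \<circ> k') ^^ m) \<or> halves_uniform V A (k \<circ> c \<circ> k')"
  proof (rule cycles_in_q_group_twice_prime[OF assms(1,2,4) P])
    show "regular_cycle V (k \<circ> c \<circ> k')" "regular_cycle V (g \<circ> d \<circ> g')"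
      using regular_cycle_conj assms(5,7) pg(1) k(1-4) g(1-4) by blast+
    show "(k \<circ> c \<circ> k') ^^ 2 \<in> P" "(g \<circ> d \<circ> g') ^^ 2 \<in> P"
      using k(5) g(5) by (simp_all only: conj_funpow[OF k(3,4)] conj_funpow[OF g(3,4)])
    show "k \<circ> c \<circ> k' \<in> aut V A" "g \<circ> d \<circ> g' \<in> aut V A"
      using pg(3) k(1,2) g(1,2) assms(6,8) by blast+
  qed
  thus ?thesis
  proof
    assume "\<exists>m. g \<circ> d \<circ> g' = (k \<circ> c \<circ> k') ^^ m"
    thus ?thesis using conjugate_power[OF k(3) _ k(4) g(3)] pg(3)[OF k(2) g(1)] by blast
  next
    assume u: "halves_uniform V A (k \<circ> c \<circ> k')"
    have "(x, (c ^^ i) x) \<in> A \<longleftrightarrow> (k x, ((k \<circ> c \<circ> k') ^^ i) (k x)) \<in> A" for x i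
    proof -
      have "k' (k x) = x" using k(3) by (metis comp_apply id_apply)
      thus ?thesis using k(1) unfolding conj_funpow[OF k(3,4)] by (simp add: aut_def)
    qed
    moreover have "k x \<in> V" if "x \<in> V" for x using pg(1)[OF k(1)] that by (simp add: permutes_in_image)
    ultimately have "halves_uniform V A c" using u unfolding halves_uniform_def by blast
    thus ?thesis by blast
  qed
qed

section \<open>Isomorphic circulants of prime order differ by a multiplier\<close>

text \<open>
  The rotation of the residues, extended by the identity so that it is a permutation of the whole
  type.
\<close>

definition succ_mod :: "nat \<Rightarrow> nat \<Rightarrow> nat" where
  "succ_mod n = (\<lambda>x. if x < n then (x + 1) mod n else x)"

definition circ_arcs :: "nat \<Rightarrow> (nat \<times> nat) set \<Rightarrow> bool" where
  "circ_arcs n A \<longleftrightarrow> A \<subseteq> {..<n} \<times> {..<n} \<and> irrefl A \<and> succ_mod n \<in> aut {..<n} A"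

text \<open>
  Membership of \<open>s\<close> in the connection set of a circulant; arguments are read modulo \<open>n\<close>, so that
  multipliers can be applied without reduction.
\<close>

definition conn :: "nat \<Rightarrow> (nat \<times> nat) set \<Rightarrow> nat \<Rightarrow> bool" where
  "conn n A s \<longleftrightarrow> (0, s mod n) \<in> A"

definition arc_iso :: "'a set \<Rightarrow> ('a \<times> 'a) set \<Rightarrow> ('a \<times> 'a) set \<Rightarrow> ('a \<Rightarrow> 'a) \<Rightarrow> bool" where
  "arc_iso V A B f \<longleftrightarrow> f permutes V \<and> (\<forall>x y. (f x, f y) \<in> B \<longleftrightarrow> (x, y) \<in> A)"

lemma succ_mod_funpow: "x < n \<Longrightarrow> (succ_mod n ^^ i) x = (x + i) mod n"
  by (induction i) (auto simp: succ_mod_def mod_Suc_eq)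

lemma succ_mod_permutes: "succ_mod n permutes {..<n}"
proof (rule bij_imp_permutes)
  show "bij_betw (succ_mod n) {..<n} {..<n}"
  proof (rule bij_betwI')
    fix x y assume "x \<in> {..<n}" "y \<in> {..<n}"
    thus "(succ_mod n x = succ_mod n y) = (x = y)"
      by (cases "Suc x = n"; cases "Suc y = n") (auto simp: succ_mod_def)
  next
    fix y assume "y \<in> {..<n}"
    thus "\<exists>x\<in>{..<n}. y = succ_mod n x"
      by (intro bexI[of _ "if y = 0 then n - 1 else y - 1"]) (auto simp: succ_mod_def)
  qed (auto simp: succ_mod_def)
qed (simp add: succ_mod_def)

lemma succ_mod_regular: "regular_cycle {..<n} (succ_mod n)"
  unfolding regular_cycle_def
proof (intro conjI ballI)
  show "succ_mod n ^^ card {..<n} = id"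
  proof
    fix x show "(succ_mod n ^^ card {..<n}) x = id x"
    proof (cases "x < n")
      case False
      hence "(succ_mod n ^^ i) x = x" for i by (induction i) (simp_all add: succ_mod_def)
      thus ?thesis by simp
    qed (simp add: succ_mod_funpow)
  qed
  fix x y assume "x \<in> {..<n}" "y \<in> {..<n}"
  thus "\<exists>i. (succ_mod n ^^ i) x = y"
    by (intro exI[of _ "n - x + y"]) (simp add: succ_mod_funpow)
qed (rule succ_mod_permutes)

lemma conn_mod [simp]: "conn n A (s mod n) = conn n A s"
  by (simp add: conn_def)

lemma conn_cong: "[s = t] (mod n) \<Longrightarrow> conn n A s = conn n A t"
  by (simp add: conn_def cong_def)

lemma circ_arcs_succ_mod:
  assumes "circ_arcs n A"
  shows "((succ_mod n ^^ i) x, (succ_mod n ^^ i) y) \<in> A \<longleftrightarrow> (x, y) \<in> A"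
  using perm_group_funpow[OF aut_perm_group, of "succ_mod n" "{..<n}" A i] assms
  by (simp add: circ_arcs_def aut_def)

lemma circ_arcs_adj:
  assumes "circ_arcs n A" and "x < n"
  shows "(x, (x + s) mod n) \<in> A \<longleftrightarrow> conn n A s"
proof -
  have "n > 0" using assms(2) by simp
  have "(x, (x + s) mod n) = ((succ_mod n ^^ x) 0, (succ_mod n ^^ x) (s mod n))"
    using \<open>n > 0\<close> assms(2) by (simp add: succ_mod_funpow mod_add_right_eq add.commute)
  thus ?thesis using circ_arcs_succ_mod[OF assms(1), of x 0 "s mod n"] by (simp add: conn_def)
qed

lemma circ_arcs_iff:
  assumes "circ_arcs n A" and "x < n" "y < n"
  shows "(x, y) \<in> A \<longleftrightarrow> conn n A (y + (n - x))"
proof -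
  have "(x + (y + (n - x))) mod n = y" using assms by simp
  thus ?thesis using circ_arcs_adj[OF assms(1,2), of "y + (n - x)"] by simp
qed

lemma not_conn_0: "circ_arcs n A \<Longrightarrow> n dvd s \<Longrightarrow> \<not> conn n A s"
  by (auto simp: circ_arcs_def conn_def irrefl_def)

lemma arc_iso_comp: "arc_iso V A B f \<Longrightarrow> arc_iso V B C g \<Longrightarrow> arc_iso V A C (g \<circ> f)"
  by (auto simp: arc_iso_def permutes_compose)

lemma arc_iso_aut: "arc_iso V A A f \<longleftrightarrow> f \<in> aut V A"
  by (auto simp: arc_iso_def aut_def)

lemma arc_iso_inv:
  assumes "arc_iso V A B f"
  obtains f' where "arc_iso V B A f'" and "f' \<circ> f = id" and "f \<circ> f' = id"
proof
  have p: "f permutes V" using assms by (simp add: arc_iso_def)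
  let ?i = "inv_into UNIV f"
  show "?i \<circ> f = id" "f \<circ> ?i = id" using permutes_inv_o[OF p] by simp_all
  have "(?i x, ?i y) \<in> A \<longleftrightarrow> (x, y) \<in> B" for x y
  proof -
    have "(f (?i x), f (?i y)) \<in> B \<longleftrightarrow> (?i x, ?i y) \<in> A" using assms by (simp add: arc_iso_def)
    thus ?thesis by (simp add: permutes_inverses(1)[OF p])
  qed
  thus "arc_iso V B A ?i" using permutes_inv[OF p] by (simp add: arc_iso_def)
qed

lemma arc_iso_fix_0:
  assumes "circ_arcs n A" "arc_iso {..<n} A B f" and "n > 0"
  obtains i where "arc_iso {..<n} A B (f \<circ> succ_mod n ^^ i)" and "(f \<circ> succ_mod n ^^ i) 0 = 0"
proof -
  have p: "f permutes {..<n}" using assms(2) by (simp add: arc_iso_def)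
  obtain i where i: "i < n" "f i = 0"
    using permutes_surj[OF p] permutes_in_image[OF p] assms(3) by (metis lessThan_iff surjD)
  have "succ_mod n ^^ i \<in> aut {..<n} A"
    using perm_group_funpow[OF aut_perm_group, of "succ_mod n"] assms(1) by (simp add: circ_arcs_def)
  hence "arc_iso {..<n} A B (f \<circ> succ_mod n ^^ i)"
    using arc_iso_comp[OF _ assms(2)] by (simp add: arc_iso_aut)
  moreover have "(f \<circ> succ_mod n ^^ i) 0 = 0" using i by (simp add: succ_mod_funpow)
  ultimately show ?thesis using that by blast
qed

definition multiplier_equiv :: "nat \<Rightarrow> (nat \<times> nat) set \<Rightarrow> (nat \<times> nat) set \<Rightarrow> bool" where
  "multiplier_equiv n A B \<longleftrightarrow> (\<exists>j. coprime j n \<and> (\<forall>s. conn n B s \<longleftrightarrow> conn n A (j * s)))"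

text \<open>
  With \<open>d = f\<^sup>-\<^sup>1 c f\<close>, where \<open>c\<close> is the rotation, the map \<open>k = f h\<^sup>-\<^sup>1\<close> is another isomorphism, and it
  satisfies \<open>k c\<^sup>m = c k\<close>.  Composed with a rotation so as to fix \<open>0\<close>, it sends \<open>m s\<close> to \<open>s\<close> for every
  residue \<open>s\<close>; thus \<open>m\<close> is a unit, and it is the desired multiplier.
\<close>

lemma multiplier_of_conjugate:
  assumes A: "circ_arcs n A" and B: "circ_arcs n B" and f: "arc_iso {..<n} A B f"
    and f': "f' \<circ> f = id" "f \<circ> f' = id" and "n > 0"
    and h: "h \<in> aut {..<n} A" "h \<circ> (f' \<circ> succ_mod n \<circ> f) = succ_mod n ^^ m \<circ> h"
  shows "multiplier_equiv n A B"
proof -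
  obtain h' where h': "arc_iso {..<n} A A h'" "h' \<circ> h = id" "h \<circ> h' = id"
    using arc_iso_inv h(1) unfolding arc_iso_aut[symmetric] by blast
  define k where "k = f \<circ> h'"
  have k: "arc_iso {..<n} A B k" unfolding k_def by (rule arc_iso_comp[OF h'(1) f])
  obtain t where t: "arc_iso {..<n} A B (k \<circ> succ_mod n ^^ t)" "(k \<circ> succ_mod n ^^ t) 0 = 0"
    using arc_iso_fix_0[OF A k \<open>n > 0\<close>] by blast
  have hf: "h (f' (succ_mod n (f x))) = (succ_mod n ^^ m) (h x)" for x using h(2) by (metis comp_apply)
  have inv: "h' (h x) = x" "h (h' x) = x" "f (f' x) = x" for x
    using f'(2) h'(2,3) by (metis comp_apply id_apply)+
  have kr: "k ((succ_mod n ^^ m) x) = succ_mod n (k x)" for x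
  proof -
    have "(succ_mod n ^^ m) x = h (f' (succ_mod n (f (h' x))))" using hf[of "h' x"] by (simp add: inv)
    thus ?thesis by (simp add: k_def inv)
  qed
  define k0 where "k0 = k \<circ> succ_mod n ^^ t"
  have comm: "(succ_mod n ^^ t) ((succ_mod n ^^ m) x) = (succ_mod n ^^ m) ((succ_mod n ^^ t) x)" for x
    by (metis add.commute comp_apply funpow_add)
  have k0r: "k0 ((succ_mod n ^^ m) x) = succ_mod n (k0 x)" for x
    by (simp add: k0_def comm kr)
  have mult: "k0 ((m * s) mod n) = s mod n" for s
  proof -
    have "k0 ((succ_mod n ^^ (m * s)) 0) = (succ_mod n ^^ s) 0"
    proof (induction s)
      case 0 thus ?case using t(2) by (simp add: k0_def)
    next
      case (Suc s)
      have "(succ_mod n ^^ (m * Suc s)) 0 = (succ_mod n ^^ m) ((succ_mod n ^^ (m * s)) 0)"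
        by (simp add: funpow_add)
      thus ?case using Suc k0r by simp
    qed
    thus ?thesis using \<open>n > 0\<close> by (simp add: succ_mod_funpow)
  qed
  have "coprime m n"
  proof -
    define g where "g = gcd m n"
    obtain a b where ab: "m = g * a" "n = g * b" unfolding g_def by (meson dvdE gcd_dvd1 gcd_dvd2)
    have "m * b mod n = 0" using ab by simp
    hence "k0 0 = b mod n" using mult[of b] by simp
    hence "n dvd b" using mult[of 0] by auto
    moreover have "b > 0" using ab(2) \<open>n > 0\<close> by (cases b) auto
    ultimately have "g * b \<le> 1 * b" using ab(2) by (simp add: dvd_imp_le)
    hence "g \<le> 1" using \<open>b > 0\<close> by (simp only: mult_le_cancel2)
    moreover have "g \<noteq> 0" using ab(2) \<open>n > 0\<close> by (cases g) auto
    ultimately have "g = 1" by simp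
    thus ?thesis by (simp add: g_def coprime_iff_gcd_eq_1)
  qed
  moreover have "conn n B s \<longleftrightarrow> conn n A (m * s)" for s
    using t(1) mult[of s] t(2) unfolding k0_def[symmetric] arc_iso_def conn_def by metis
  ultimately show ?thesis unfolding multiplier_equiv_def by blast
qed

lemma pulled_back_rotation:
  assumes "circ_arcs n B" and f: "arc_iso {..<n} A B f" and f': "arc_iso {..<n} B A f'"
    and "f' \<circ> f = id" "f \<circ> f' = id"
  shows "regular_cycle {..<n} (f' \<circ> succ_mod n \<circ> f)" and "f' \<circ> succ_mod n \<circ> f \<in> aut {..<n} A"
proof -
  show "regular_cycle {..<n} (f' \<circ> succ_mod n \<circ> f)"
    using assms by (intro regular_cycle_conj succ_mod_regular) (simp_all add: arc_iso_def)
  have "arc_iso {..<n} B B (succ_mod n)" using assms(1) by (simp add: circ_arcs_def arc_iso_aut)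
  thus "f' \<circ> succ_mod n \<circ> f \<in> aut {..<n} A"
    using arc_iso_comp[OF f arc_iso_comp[OF _ f']] by (simp add: arc_iso_aut comp_assoc)
qed

theorem multiplier_prime:
  assumes "prime p" and "circ_arcs p A" "circ_arcs p B" and f: "arc_iso {..<p} A B f"
  shows "multiplier_equiv p A B"
proof -
  obtain f' where f': "arc_iso {..<p} B A f'" "f' \<circ> f = id" "f \<circ> f' = id" using arc_iso_inv[OF f] by blast
  note pb = pulled_back_rotation[OF assms(3) f f']
  obtain h m where "h \<in> aut {..<p} A" "h \<circ> (f' \<circ> succ_mod p \<circ> f) = succ_mod p ^^ m \<circ> h"
    using regular_cycles_conjugate_prime[OF _ _ assms(1) succ_mod_regular _ pb] assms(2)
    by (auto simp: circ_arcs_def)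
  thus ?thesis using multiplier_of_conjugate[OF assms(2-4) f'(2,3)] prime_gt_0_nat[OF assms(1)] by blast
qed

lemma multiplier_or_uniform:
  assumes "prime q" "odd q" "n = 2 * q" and "circ_arcs n A" "circ_arcs n B" and f: "arc_iso {..<n} A B f"
  shows "multiplier_equiv n A B \<or> (\<forall>s t. odd s \<longrightarrow> odd t \<longrightarrow> conn n A s \<longleftrightarrow> conn n A t)"
proof -
  have n: "n > 0" using prime_gt_0_nat[OF assms(1)] assms(3) by simp
  obtain f' where f': "arc_iso {..<n} B A f'" "f' \<circ> f = id" "f \<circ> f' = id" using arc_iso_inv[OF f] by blast
  note pb = pulled_back_rotation[OF assms(5) f f']
  have "(\<exists>h\<in>aut {..<n} A. \<exists>m. h \<circ> (f' \<circ> succ_mod n \<circ> f) = succ_mod n ^^ m \<circ> h) \<or> halves_uniform {..<n} A (succ_mod n)"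
    using regular_cycles_conjugate_twice_prime[OF _ _ assms(1,2) succ_mod_regular _ pb] assms(3,4)
    by (auto simp: circ_arcs_def)
  thus ?thesis
  proof
    assume "\<exists>h\<in>aut {..<n} A. \<exists>m. h \<circ> (f' \<circ> succ_mod n \<circ> f) = succ_mod n ^^ m \<circ> h"
    thus ?thesis using multiplier_of_conjugate[OF assms(4-6) f'(2,3) n] by blast
  next
    assume "halves_uniform {..<n} A (succ_mod n)"
    moreover have "(succ_mod n ^^ i) 0 = i mod n" for i using n by (simp add: succ_mod_funpow)
    ultimately show ?thesis using n unfolding halves_uniform_def conn_def by (metis lessThan_iff)
  qed
qed

section \<open>Isomorphic circulants of twice prime order differ by a multiplier\<close>

text \<open>
  The isomorphism is multiplication by the unit itself; it runs from \<open>B\<close> to \<open>A\<close>.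
\<close>

lemma multiplier_imp_iso:
  assumes "n > 0" and A: "circ_arcs n A" and B: "circ_arcs n B" and "multiplier_equiv n A B"
  shows "\<exists>f. arc_iso {..<n} B A f"
proof -
  obtain j where j: "coprime j n" "\<And>s. conn n B s \<longleftrightarrow> conn n A (j * s)"
    using assms(4) by (auto simp: multiplier_equiv_def)
  define f where "f = (\<lambda>x. if x < n then (j * x) mod n else x)"
  have "bij_betw f {..<n} {..<n}"
  proof (rule bij_betw_imageI)
    show inj: "inj_on f {..<n}"
    proof (rule inj_onI)
      fix x y assume xy: "x \<in> {..<n}" "y \<in> {..<n}" "f x = f y"
      hence "[j * x = j * y] (mod n)" by (simp add: f_def cong_def)
      hence "[x = y] (mod n)" using j(1) cong_mult_lcancel_nat by blast
      thus "x = y" using xy by (simp add: cong_def)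
    qed
    show "f ` {..<n} = {..<n}"
      by (rule endo_inj_surj[OF _ _ inj]) (use assms(1) in \<open>auto simp: f_def\<close>)
  qed
  hence "f permutes {..<n}" by (rule bij_imp_permutes) (simp add: f_def)
  moreover have "(f x, f y) \<in> A \<longleftrightarrow> (x, y) \<in> B" for x y
  proof (cases "x < n \<and> y < n")
    case True
    have "[(j * y mod n + (n - j * x mod n)) + j * x = j * (y + (n - x)) + j * x] (mod n)"
    proof -
      have "[(j * y mod n + (n - j * x mod n)) + j * x = j * y mod n + (n - j * x mod n) + j * x mod n] (mod n)"
        by (simp add: cong_def mod_add_right_eq)
      also have "j * y mod n + (n - j * x mod n) + j * x mod n = j * y mod n + n"
        using mod_less_divisor[OF \<open>n > 0\<close>, of "j * x"] by linarith
      also have "[j * y mod n + n = j * y + n * j] (mod n)" by (simp add: cong_def)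
      also have "j * y + n * j = j * (y + (n - x)) + j * x"
      proof -
        have "y + n = (y + (n - x)) + x" using True by simp
        hence "j * (y + n) = j * (y + (n - x)) + j * x" by (simp only: distrib_left)
        thus ?thesis by (simp add: distrib_left mult.commute)
      qed
      finally show ?thesis .
    qed
    hence "[j * y mod n + (n - j * x mod n) = j * (y + (n - x))] (mod n)"
      by (simp only: cong_add_rcancel_nat)
    hence "conn n A (f y + (n - f x)) \<longleftrightarrow> conn n B (y + (n - x))"
      using True conn_cong j(2) by (simp add: f_def)
    moreover have "f x < n" "f y < n" using True by (simp_all add: f_def)
    ultimately show ?thesis using circ_arcs_iff[OF A] circ_arcs_iff[OF B] True by simp
  next
    case False
    moreover have "f z < n \<longleftrightarrow> z < n" for z using assms(1) by (simp add: f_def)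
    ultimately show ?thesis using A B by (fastforce simp: circ_arcs_def)
  qed
  ultimately show ?thesis unfolding arc_iso_def by blast
qed

text \<open>
  Complementation exchanges the two degenerate cases, all arcs and no arcs between residues of
  different parity.
\<close>

definition co_arcs :: "nat \<Rightarrow> (nat \<times> nat) set \<Rightarrow> (nat \<times> nat) set" where
  "co_arcs n A = {(x, y). x < n \<and> y < n \<and> x \<noteq> y \<and> (x, y) \<notin> A}"

lemma arc_iso_co_arcs: "arc_iso {..<n} A B f \<Longrightarrow> arc_iso {..<n} (co_arcs n A) (co_arcs n B) f"
proof -
  assume f: "arc_iso {..<n} A B f"
  hence p: "f permutes {..<n}" by (simp add: arc_iso_def)
  have "f x < n \<longleftrightarrow> x < n" "f x = f y \<longleftrightarrow> x = y" for x y
    using permutes_in_image[OF p, of x] permutes_inj[OF p] by (auto dest: injD)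
  thus ?thesis using f by (simp add: arc_iso_def co_arcs_def)
qed

lemma circ_arcs_co: "circ_arcs n A \<Longrightarrow> circ_arcs n (co_arcs n A)"
  using arc_iso_co_arcs[of n A A "succ_mod n"] unfolding circ_arcs_def arc_iso_aut
  by (auto simp: co_arcs_def irrefl_def)

lemma conn_co_arcs: "n > 0 \<Longrightarrow> conn n (co_arcs n A) s \<longleftrightarrow> \<not> n dvd s \<and> \<not> conn n A s"
  by (auto simp: conn_def co_arcs_def dvd_eq_mod_eq_0)

lemma multiplier_equiv_co_arcs:
  assumes "n > 0" "circ_arcs n A" "circ_arcs n B" and "multiplier_equiv n (co_arcs n A) (co_arcs n B)"
  shows "multiplier_equiv n A B"
proof -
  obtain j where j: "coprime j n" "\<And>s. conn n (co_arcs n B) s \<longleftrightarrow> conn n (co_arcs n A) (j * s)"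
    using assms(4) by (auto simp: multiplier_equiv_def)
  have "n dvd j * s \<longleftrightarrow> n dvd s" for s
    using j(1) by (simp add: coprime_dvd_mult_right_iff coprime_commute)
  hence "conn n B s \<longleftrightarrow> conn n A (j * s)" for s
    using j(2)[of s] not_conn_0 assms(2,3) unfolding conn_co_arcs[OF assms(1)] by metis
  thus ?thesis using j(1) unfolding multiplier_equiv_def by blast
qed

lemma multiplier_equiv_sym:
  assumes "n > 0" "multiplier_equiv n A B"
  shows "multiplier_equiv n B A"
proof -
  obtain j where j: "coprime j n" "\<And>s. conn n B s \<longleftrightarrow> conn n A (j * s)"
    using assms(2) by (auto simp: multiplier_equiv_def)
  obtain i where i: "[j * i = 1] (mod n)" using cong_solve_coprime_nat[OF j(1)] by auto
  have "conn n A s \<longleftrightarrow> conn n B (i * s)" for s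
  proof -
    have "[s = j * (i * s)] (mod n)"
      using cong_sym[OF cong_scalar_right[OF i, of s]] by (simp add: mult.assoc)
    hence "conn n A s \<longleftrightarrow> conn n A (j * (i * s))" by (rule conn_cong)
    thus ?thesis by (simp only: j(2))
  qed
  moreover have "coprime i n" using i by (metis coprime_iff_invertible_nat mult.commute One_nat_def)
  ultimately show ?thesis unfolding multiplier_equiv_def by blast
qed

lemma same_parity:
  assumes "circ_arcs n B" "even n" and "\<And>s. odd s \<Longrightarrow> \<not> conn n B s" and "(x, y) \<in> B"
  shows "even x \<longleftrightarrow> even y"
proof -
  have xy: "x < n" "y < n" using assms(1,4) by (auto simp: circ_arcs_def)
  hence "even (y + (n - x))" using circ_arcs_iff[OF assms(1) xy] assms(3,4) by blast
  thus ?thesis using xy assms(2) by auto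
qed

text \<open>
  If all arcs join residues of equal parity and there is some arc \<open>0 \<rightarrow> 2t\<close>, then the even residues
  are connected by steps of \<open>2t\<close>, as \<open>t\<close> is prime to \<open>q\<close>.  An isomorphism fixing \<open>0\<close> therefore preserves
  even residues, and halving them gives an isomorphism of circulants of order \<open>q\<close>.
\<close>

lemma multiplier_no_odd:
  assumes q: "prime q" "odd q" "n = 2 * q" and A: "circ_arcs n A" and B: "circ_arcs n B"
    and f: "arc_iso {..<n} A B f"
    and noA: "\<And>s. odd s \<Longrightarrow> \<not> conn n A s" and noB: "\<And>s. odd s \<Longrightarrow> \<not> conn n B s"
  shows "multiplier_equiv n A B"
proof (cases "\<exists>s. conn n A s")
  case False
  have q0: "q > 0" and n: "n > 0" using prime_gt_0_nat[OF q(1)] q(3) by auto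
  have "A = {}" using circ_arcs_iff[OF A] A False unfolding circ_arcs_def by fastforce
  moreover obtain f' where "arc_iso {..<n} B A f'" using arc_iso_inv[OF f] by blast
  ultimately have "B = {}" by (auto simp: arc_iso_def)
  thus ?thesis using \<open>A = {}\<close> by (auto simp: multiplier_equiv_def conn_def intro: exI[of _ 1])
next
  case True
  have q0: "q > 0" and n: "n > 0" "even n" using prime_gt_0_nat[OF q(1)] q(3) by auto
  obtain i where g: "arc_iso {..<n} A B (f \<circ> succ_mod n ^^ i)" "(f \<circ> succ_mod n ^^ i) 0 = 0"
    using arc_iso_fix_0[OF A f n(1)] by blast
  define g where "g = f \<circ> succ_mod n ^^ i"
  note g = g[folded g_def]
  have gp: "g permutes {..<n}" using g(1) by (simp add: arc_iso_def)
  have glt: "g x < n \<longleftrightarrow> x < n" for x using permutes_in_image[OF gp, of x] by simp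
  obtain t where t: "conn n A (2 * t)" using True noA by (metis evenE)
  have "\<not> q dvd t" using t not_conn_0[OF A, of "2 * t"] q(3) by auto
  hence "coprime t q" using q(1) by (metis coprime_commute prime_imp_coprime)
  have even_mult: "even (g ((2 * t * k) mod n))" for k
  proof (induction k)
    case 0 thus ?case using g(2) by simp
  next
    case (Suc k)
    have "((2 * t * k) mod n, ((2 * t * k) mod n + 2 * t) mod n) \<in> A"
      using circ_arcs_adj[OF A, of "(2 * t * k) mod n" "2 * t"] t n by simp
    moreover have "((2 * t * k) mod n + 2 * t) mod n = (2 * t * Suc k) mod n"
      using mod_add_left_eq[of "2 * t * k" n "2 * t"] by (simp add: add.commute)
    ultimately have "(g ((2 * t * k) mod n), g ((2 * t * Suc k) mod n)) \<in> B"
      using g(1) by (simp add: arc_iso_def)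
    thus ?case using same_parity[OF B n(2)] noB Suc by blast
  qed
  have even_g: "even (g (2 * x))" if "x < q" for x
  proof -
    obtain t' where "[t * t' = 1] (mod q)" using cong_solve_coprime_nat[OF \<open>coprime t q\<close>] by auto
    hence "[t * t' * x = 1 * x] (mod q)" by (rule cong_scalar_right)
    hence "(2 * t * (t' * x)) mod n = 2 * x"
      using \<open>x < q\<close> unfolding q(3) by (simp add: cong_def mult.assoc mult_mod_right[symmetric])
    thus ?thesis using even_mult[of "t' * x"] by simp
  qed
  define h where "h = (\<lambda>x. if x < q then g (2 * x) div 2 else x)"
  have h2: "2 * h x = g (2 * x)" if "x < q" for x using even_g[OF that] that by (simp add: h_def)
  have hlt: "h x < q \<longleftrightarrow> x < q" for x
    using glt[of "2 * x"] q(3) by (auto simp: h_def)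
  define half where "half = (\<lambda>A. {(x, y). x < q \<and> y < q \<and> (2 * x, 2 * y) \<in> (A :: (nat \<times> nat) set)})"
  have circ_half: "circ_arcs q (half C)" if C: "circ_arcs n C" for C
  proof -
    have "(succ_mod q x, succ_mod q y) \<in> half C \<longleftrightarrow> (x, y) \<in> half C" for x y
    proof (cases "x < q \<and> y < q")
      case True
      have "2 * succ_mod q z = (succ_mod n ^^ 2) (2 * z)" if "z < q" for z
        using that q(3) by (simp add: succ_mod_funpow) (simp add: succ_mod_def mult_mod_right)
      thus ?thesis using True circ_arcs_succ_mod[OF C, of 2 "2 * x" "2 * y"]
        by (simp add: half_def) (simp add: succ_mod_def)
    qed (auto simp: half_def succ_mod_def split: if_splits)
    thus ?thesis using C succ_mod_permutes[of q] by (auto simp: circ_arcs_def aut_def half_def irrefl_def)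
  qed
  have "bij_betw h {..<q} {..<q}"
  proof (rule bij_betw_imageI)
    show inj: "inj_on h {..<q}"
    proof (rule inj_onI)
      fix x y assume xy: "x \<in> {..<q}" "y \<in> {..<q}" "h x = h y"
      hence "g (2 * x) = g (2 * y)" using h2[of x] h2[of y] by simp
      thus "x = y" using injD[OF permutes_inj[OF gp], of "2 * x" "2 * y"] by simp
    qed
    show "h ` {..<q} = {..<q}"
      by (rule endo_inj_surj[OF _ _ inj]) (use hlt in auto)
  qed
  hence "h permutes {..<q}" by (rule bij_imp_permutes) (simp add: h_def)
  moreover have "(h x, h y) \<in> half B \<longleftrightarrow> (x, y) \<in> half A" for x y
    using hlt[of x] hlt[of y] h2[of x] h2[of y] g(1) by (auto simp: half_def arc_iso_def)
  ultimately have "arc_iso {..<q} (half A) (half B) h" by (simp add: arc_iso_def)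
  then obtain j where j: "coprime j q" "\<And>s. conn q (half B) s \<longleftrightarrow> conn q (half A) (j * s)"
    using multiplier_prime[OF q(1) circ_half[OF A] circ_half[OF B]] unfolding multiplier_equiv_def by blast
  have conn_half: "conn q (half C) s \<longleftrightarrow> conn n C (2 * s)" for C s
  proof -
    have "2 * (s mod q) = 2 * s mod n" unfolding q(3) by (rule mult_mod_right)
    thus ?thesis using q0 by (simp add: conn_def half_def)
  qed
  \<comment> \<open>the multiplier can be made odd without changing it modulo \<open>q\<close>\<close>
  define k where "k = (if odd j then j else j + q)"
  have "odd k" using q(2) by (simp add: k_def)
  moreover have "coprime k q" using j(1) by (simp add: k_def coprime_iff_gcd_eq_1)
  ultimately have "coprime k n" unfolding q(3) by simp
  moreover have "conn n B s \<longleftrightarrow> conn n A (k * s)" for s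
  proof (cases "odd s")
    case True
    thus ?thesis using noA noB \<open>odd k\<close> by simp
  next
    case False
    then obtain u where u: "s = 2 * u" by auto
    have "conn n B s \<longleftrightarrow> conn n A (2 * (j * u))" using j(2)[of u] u by (simp add: conn_half)
    also have "\<dots> \<longleftrightarrow> conn n A (k * s)"
    proof (rule conn_cong)
      have "k * s = 2 * (j * u) + (if odd j then 0 else n * u)"
        by (simp add: k_def u q(3) algebra_simps)
      thus "[2 * (j * u) = k * s] (mod n)" by (simp add: cong_def)
    qed
    finally show ?thesis .
  qed
  ultimately show ?thesis unfolding multiplier_equiv_def by blast
qed

text \<open>
  A circulant with all arcs between the two parities is connected, one with no such arcs is not.
\<close>

lemma all_odd_imp_some_odd:
  assumes n: "n > 1" "even n" and A: "circ_arcs n A" and B: "circ_arcs n B" and f: "arc_iso {..<n} A B f"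
    and uA: "\<And>s. odd s \<Longrightarrow> conn n A s"
  shows "\<exists>s. odd s \<and> conn n B s"
proof (rule ccontr)
  assume "\<not> ?thesis"
  hence noB: "\<And>s. odd s \<Longrightarrow> \<not> conn n B s" by blast
  have par: "even (f x) \<longleftrightarrow> even (f y)" if "x < n" "y < n" "odd (x + y)" for x y
  proof -
    have "(x, y) \<in> A" using circ_arcs_iff[OF A that(1,2)] uA that n by simp
    hence "(f x, f y) \<in> B" using f by (simp add: arc_iso_def)
    thus ?thesis using same_parity[OF B n(2)] noB by blast
  qed
  have all: "even (f x) \<longleftrightarrow> even (f 0)" if "x < n" for x
    using par[of x 0] par[of x 1] par[of 1 0] that n by (cases "even x") auto
  have p: "f permutes {..<n}" using f by (simp add: arc_iso_def)
  obtain x y where xy: "f x = 0" "f y = 1" using permutes_surj[OF p] by (metis surjD)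
  hence "x < n" "y < n" using permutes_in_image[OF p, of x] permutes_in_image[OF p, of y] n by auto
  thus False using all[of x] all[of y] xy by simp
qed

text \<open>
  If there is no multiplier, both circulants are degenerate, and of the same kind; up to
  complementation both have no arcs between the two parities.
\<close>

theorem multiplier_twice_prime:
  assumes q: "prime q" "odd q" "n = 2 * q" and A: "circ_arcs n A" and B: "circ_arcs n B"
    and f: "arc_iso {..<n} A B f"
  shows "multiplier_equiv n A B"
proof (rule ccontr)
  assume no: "\<not> ?thesis"
  have n: "n > 1" "even n" "n > 0" using prime_gt_0_nat[OF q(1)] q(3) by auto
  obtain f' where f': "arc_iso {..<n} B A f'" using arc_iso_inv[OF f] by blast
  have uA: "conn n A s \<longleftrightarrow> conn n A t" if "odd s" "odd t" for s t
    using multiplier_or_uniform[OF q A B f] no that by blast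
  have uB: "conn n B s \<longleftrightarrow> conn n B t" if "odd s" "odd t" for s t
    using multiplier_or_uniform[OF q B A f'] no multiplier_equiv_sym[OF n(3)] that by blast
  have odd1: "odd (1 :: nat)" by simp
  show False
  proof (cases "conn n A 1")
    case True
    hence allA: "\<And>s. odd s \<Longrightarrow> conn n A s" using uA[OF odd1] by blast
    hence "\<exists>s. odd s \<and> conn n B s" by (rule all_odd_imp_some_odd[OF n(1,2) A B f])
    hence allB: "\<And>s. odd s \<Longrightarrow> conn n B s" using uB by blast
    have "multiplier_equiv n (co_arcs n A) (co_arcs n B)"
      using allA allB by (intro multiplier_no_odd[OF q circ_arcs_co[OF A] circ_arcs_co[OF B] arc_iso_co_arcs[OF f]])
        (simp_all add: conn_co_arcs[OF n(3)])
    thus False using multiplier_equiv_co_arcs[OF n(3) A B] no by blast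
  next
    case False
    hence noA: "\<And>s. odd s \<Longrightarrow> \<not> conn n A s" using uA[OF odd1] by blast
    have "\<not> conn n B 1"
    proof
      assume "conn n B 1"
      hence "\<And>s. odd s \<Longrightarrow> conn n B s" using uB[OF odd1] by blast
      hence "\<exists>s. odd s \<and> conn n A s" by (rule all_odd_imp_some_odd[OF n(1,2) B A f'])
      thus False using noA by blast
    qed
    hence "\<And>s. odd s \<Longrightarrow> \<not> conn n B s" using uB[OF odd1] by blast
    thus False using multiplier_no_odd[OF q A B f noA] no by blast
  qed
qed

section \<open>Circulants coded as necklaces\<close>

lemma card_quotient_kernel:
  assumes "E = {(x, y). x \<in> X \<and> y \<in> X \<and> \<phi> x = \<phi> y}"
  shows "card (X // E) = card (\<phi> ` X)"
proof -
  have cls: "E `` {x} = {y\<in>X. \<phi> y = \<phi> x}" if "x \<in> X" for x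
    using that assms by auto
  have "inj_on (\<lambda>b. {y\<in>X. \<phi> y = b}) (\<phi> ` X)" by (auto simp: inj_on_def)
  moreover have "X // E = (\<lambda>b. {y\<in>X. \<phi> y = b}) ` \<phi> ` X"
    using cls by (auto simp: quotient_def image_image)
  ultimately show ?thesis by (simp add: card_image)
qed

lemma map_prod_image_iff:
  assumes "bij f"
  shows "map_prod f f ` A = B \<longleftrightarrow> (\<forall>x y. (f x, f y) \<in> B \<longleftrightarrow> (x, y) \<in> A)"
proof
  assume "map_prod f f ` A = B"
  thus "\<forall>x y. (f x, f y) \<in> B \<longleftrightarrow> (x, y) \<in> A" using bij_is_inj[OF assms] by (auto dest: injD)
next
  assume *: "\<forall>x y. (f x, f y) \<in> B \<longleftrightarrow> (x, y) \<in> A"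
  show "map_prod f f ` A = B"
  proof safe
    fix u v assume "(u, v) \<in> B"
    moreover obtain x y where "u = f x" "v = f y" using bij_is_surj[OF assms] by (metis surjD)
    ultimately show "(u, v) \<in> map_prod f f ` A" using * by force
  qed (use * in auto)
qed

lemma circulant_iff: "circulant n G \<longleftrightarrow> pverts G = {..<n} \<and> circ_arcs n (parcs G)"
proof -
  have b: "bij (succ_mod n)" using succ_mod_permutes permutes_bij by blast
  have img: "map_prod (\<lambda>v. (v + 1) mod n) (\<lambda>v. (v + 1) mod n) ` A = map_prod (succ_mod n) (succ_mod n) ` A"
    if "A \<subseteq> {..<n} \<times> {..<n}" for A
    by (rule image_cong) (use that in \<open>auto simp: succ_mod_def\<close>)
  have "pair_digraph G \<longleftrightarrow> parcs G \<subseteq> {..<n} \<times> {..<n} \<and> irrefl (parcs G)" if "pverts G = {..<n}"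
  proof
    assume "pair_digraph G"
    then interpret pair_digraph G .
    show "parcs G \<subseteq> {..<n} \<times> {..<n} \<and> irrefl (parcs G)"
      using that arc_fst_in_verts arc_snd_in_verts pair_no_loops unfolding irrefl_def by fastforce
  next
    assume *: "parcs G \<subseteq> {..<n} \<times> {..<n} \<and> irrefl (parcs G)"
    show "pair_digraph G"
    proof unfold_locales
      show "finite (parcs G)" using * finite_subset[of "parcs G" "{..<n} \<times> {..<n}"] by simp
    qed (use * that in \<open>auto simp: irrefl_def\<close>)
  qed
  hence "circulant n G \<longleftrightarrow> pverts G = {..<n} \<and> parcs G \<subseteq> {..<n} \<times> {..<n} \<and> irrefl (parcs G) \<and>
      map_prod (succ_mod n) (succ_mod n) ` parcs G = parcs G"
    unfolding circulant_def using img[of "parcs G"] by argo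
  thus ?thesis
    unfolding circ_arcs_def aut_def mem_Collect_eq map_prod_image_iff[OF b]
    using succ_mod_permutes[of n] by blast
qed

lemma digraph_iso_circulant_iff:
  assumes "circulant n G" and "circulant n H"
  shows "digraph_iso (with_proj G) (with_proj H) \<longleftrightarrow> (\<exists>f. arc_iso {..<n} (parcs G) (parcs H) f)"
proof -
  have "pair_wf_digraph G"
    using assms(1) by (simp add: circulant_def pair_digraph_def pair_fin_digraph_def)
  note iff = digraph_iso_with_proj_iff[OF this, of H]
  have V: "pverts G = {..<n}" "pverts H = {..<n}" "parcs G \<subseteq> {..<n} \<times> {..<n}"
    using assms by (auto simp: circulant_iff circ_arcs_def)
  show ?thesis
  proof
    assume "digraph_iso (with_proj G) (with_proj H)"
    then obtain f where f: "bij_betw f {..<n} {..<n}" "map_prod f f ` parcs G = parcs H"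
      unfolding iff V(1,2) by blast
    define f' where "f' = (\<lambda>x. if x < n then f x else x)"
    have "bij_betw f' {..<n} {..<n}"
      using f(1) by (rule iffD1[OF bij_betw_cong, rotated]) (simp add: f'_def)
    hence p: "f' permutes {..<n}" by (rule bij_imp_permutes) (simp add: f'_def)
    have "map_prod f' f' ` parcs G = map_prod f f ` parcs G"
      by (rule image_cong) (use V(3) in \<open>auto simp: f'_def\<close>)
    hence "map_prod f' f' ` parcs G = parcs H" using f(2) by (rule trans)
    hence "arc_iso {..<n} (parcs G) (parcs H) f'"
      using p unfolding map_prod_image_iff[OF permutes_bij[OF p]] arc_iso_def by (rule conjI[rotated])
    thus "\<exists>f. arc_iso {..<n} (parcs G) (parcs H) f" by blast
  next
    assume "\<exists>f. arc_iso {..<n} (parcs G) (parcs H) f"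
    then obtain f where p: "f permutes {..<n}"
      and f: "\<forall>x y. (f x, f y) \<in> parcs H \<longleftrightarrow> (x, y) \<in> parcs G" by (auto simp: arc_iso_def)
    have "map_prod f f ` parcs G = parcs H"
      by (rule iffD2[OF map_prod_image_iff[OF permutes_bij[OF p]] f])
    thus "digraph_iso (with_proj G) (with_proj H)"
      unfolding iff V(1,2) using permutes_imp_bij[OF p] by blast
  qed
qed

lemma symmetric_with_proj_iff: "symmetric (with_proj G) \<longleftrightarrow> sym (parcs G)"
  by (simp add: symmetric_def arcs_ends_def arc_to_ends_def)

lemma sym_circ_arcs_iff:
  assumes "n > 0" "circ_arcs n A"
  shows "sym A \<longleftrightarrow> (\<forall>s. conn n A s \<longleftrightarrow> conn n A ((n - 1) * s))"
proof -
  have cong: "[x + (n - y) = (n - 1) * (y + (n - x))] (mod n)" if "x < n" "y < n" for x y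
  proof -
    have "(n - 1) * (y + (n - x)) + (y + (n - x)) = n * (y + (n - x))"
      using assms(1) by (cases n) auto
    moreover have "x + (n - y) + (y + (n - x)) = n * 2" using that by simp
    ultimately have "[x + (n - y) + (y + (n - x)) = (n - 1) * (y + (n - x)) + (y + (n - x))] (mod n)"
      by (simp add: cong_def)
    thus ?thesis by (simp only: cong_add_rcancel_nat)
  qed
  have swap: "(y, x) \<in> A \<longleftrightarrow> conn n A ((n - 1) * (y + (n - x)))" if "x < n" "y < n" for x y
    using circ_arcs_iff[OF assms(2) that(2,1)] conn_cong[OF cong[OF that]] by simp
  show ?thesis
  proof
    assume "sym A"
    show "\<forall>s. conn n A s \<longleftrightarrow> conn n A ((n - 1) * s)"
    proof
      fix s
      have "conn n A s \<longleftrightarrow> (s mod n, 0) \<in> A" using \<open>sym A\<close> by (auto simp: conn_def dest: symD)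
      also have "\<dots> \<longleftrightarrow> conn n A ((n - 1) * (s mod n + n))" using swap[of 0 "s mod n"] assms(1) by simp
      also have "\<dots> \<longleftrightarrow> conn n A ((n - 1) * s)"
        by (rule conn_cong, rule cong_scalar_left) (simp add: cong_def)
      finally show "conn n A s \<longleftrightarrow> conn n A ((n - 1) * s)" .
    qed
  next
    assume *: "\<forall>s. conn n A s \<longleftrightarrow> conn n A ((n - 1) * s)"
    show "sym A"
    proof (rule symI)
      fix x y assume "(x, y) \<in> A"
      moreover then have xy: "x < n" "y < n" using assms(2) by (auto simp: circ_arcs_def)
      ultimately show "(y, x) \<in> A" using swap[OF xy] circ_arcs_iff[OF assms(2) xy] * by simp
    qed
  qed
qed

definition arcs_of :: "nat \<Rightarrow> (nat \<Rightarrow> bool) \<Rightarrow> (nat \<times> nat) set" where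
  "arcs_of n Q = {(x, y). x < n \<and> y < n \<and> Q (y + (n - x))}"

lemma circ_arcs_arcs_of:
  assumes "n > 0" and Q: "\<And>s t. [s = t] (mod n) \<Longrightarrow> Q s = Q t" and "\<not> Q 0"
  shows "circ_arcs n (arcs_of n Q)" and "conn n (arcs_of n Q) s = Q s"
proof -
  have "(succ_mod n x, succ_mod n y) \<in> arcs_of n Q \<longleftrightarrow> (x, y) \<in> arcs_of n Q" for x y
  proof (cases "x < n \<and> y < n")
    case True
    have lt: "succ_mod n x < n" "succ_mod n y < n" using assms(1) True by (simp_all add: succ_mod_def)
    have "[succ_mod n y + (n - succ_mod n x) + succ_mod n x = succ_mod n y + n] (mod n)" using lt by simp
    also have "[succ_mod n y + n = y + 1 + n] (mod n)"
      by (rule cong_add) (use True in \<open>simp_all add: succ_mod_def cong_def\<close>)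
    also have "y + 1 + n = y + (n - x) + (x + 1)" using True by simp
    also have "[y + (n - x) + (x + 1) = y + (n - x) + succ_mod n x] (mod n)"
      by (rule cong_add) (use True in \<open>simp_all add: succ_mod_def cong_def\<close>)
    finally have "[succ_mod n y + (n - succ_mod n x) = y + (n - x)] (mod n)"
      by (simp only: cong_add_rcancel_nat)
    from Q[OF this] show ?thesis using True lt by (simp add: arcs_of_def)
  next
    case False
    thus ?thesis using assms(1) by (auto simp: arcs_of_def succ_mod_def split: if_splits)
  qed
  moreover have "\<not> Q n" using Q[of n 0] assms(3) by (simp add: cong_def)
  ultimately show "circ_arcs n (arcs_of n Q)"
    using succ_mod_permutes by (auto simp: circ_arcs_def aut_def irrefl_def arcs_of_def)
  have "Q (s mod n + n) = Q s" by (rule Q) (simp add: cong_def)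
  thus "conn n (arcs_of n Q) s = Q s" using assms(1) by (simp add: conn_def arcs_of_def)
qed

text \<open>
  What the orders \<open>p\<close> and \<open>2q\<close> have in common: the units are the powers of \<open>g\<close>, they fix the
  residues in \<open>W\<close>, and they act on the other nonzero residues, enumerated by \<open>e\<close> with period \<open>L\<close>, by
  shifting indices by multiples of \<open>d\<close>.
\<close>

locale circulant_coding =
  fixes n d L g :: nat and W :: "nat set" and e :: "nat \<Rightarrow> nat"
  assumes n: "n > 0" and L: "L > 0" "even L"
    and multiplier: "circ_arcs n A \<Longrightarrow> circ_arcs n B \<Longrightarrow> arc_iso {..<n} A B f \<Longrightarrow> multiplier_equiv n A B"
    and coprime_g: "coprime g n" and units: "coprime j n \<Longrightarrow> \<exists>i. [j = g ^ i] (mod n)"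
    and e_shift: "e (k + d * i) = g ^ i * e k"
    and e_cong: "[e k = e l] (mod n) \<longleftrightarrow> [k = l] (mod L)"
    and e_neg: "[e (k + L div 2) = (n - 1) * e k] (mod n)"
    and W: "W \<subseteq> {0<..<n}" and W_fixed: "w \<in> W \<Longrightarrow> coprime j n \<Longrightarrow> [j * w = w] (mod n)"
    and cover: "\<not> n dvd s \<Longrightarrow> (\<exists>w\<in>W. [s = w] (mod n)) \<or> (\<exists>k. [s = e k] (mod n))"
    and not_W: "w \<in> W \<Longrightarrow> \<not> [e k = w] (mod n)" and not_0: "\<not> n dvd e k"
begin

definition code :: "(nat \<times> nat) set \<Rightarrow> nat \<Rightarrow> bool" where
  "code A = (\<lambda>k. conn n A (e k))"

lemma code_periodic: "code A \<in> periodic L"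
proof -
  have "conn n A (e (k + L)) = conn n A (e k)" for k
    by (rule conn_cong, rule iffD2[OF e_cong]) (simp add: cong_def)
  thus ?thesis by (simp add: periodic_def code_def)
qed

lemma multiplier_equiv_iff:
  assumes A: "circ_arcs n A" and B: "circ_arcs n B"
  shows "multiplier_equiv n A B \<longleftrightarrow>
    {w\<in>W. conn n A w} = {w\<in>W. conn n B w} \<and> (code A, code B) \<in> rotation d"
proof
  assume "multiplier_equiv n A B"
  then obtain j where j: "coprime j n" "\<And>s. conn n B s \<longleftrightarrow> conn n A (j * s)"
    by (auto simp: multiplier_equiv_def)
  obtain i where i: "[j = g ^ i] (mod n)" using units[OF j(1)] by blast
  have "conn n B w \<longleftrightarrow> conn n A w" if "w \<in> W" for w
    using j(2) conn_cong[OF W_fixed[OF that j(1)]] by simp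
  moreover have "code B k = code A (k + d * i)" for k
    using j(2) conn_cong[OF cong_scalar_right[OF i]] by (simp add: code_def e_shift)
  hence "code B = (\<lambda>k. code A (k + d * i))" by (rule ext)
  ultimately show "{w\<in>W. conn n A w} = {w\<in>W. conn n B w} \<and> (code A, code B) \<in> rotation d"
    unfolding rotation_def by blast
next
  assume *: "{w\<in>W. conn n A w} = {w\<in>W. conn n B w} \<and> (code A, code B) \<in> rotation d"
  then obtain i where "code B = (\<lambda>k. code A (k + d * i))" unfolding rotation_def by blast
  hence i: "code B k = code A (k + d * i)" for k by (rule fun_cong)
  have gi: "coprime (g ^ i) n" using coprime_g by simp
  have "conn n B s \<longleftrightarrow> conn n A (g ^ i * s)" for s
  proof (cases "n dvd s")
    case True
    thus ?thesis using not_conn_0[OF A] not_conn_0[OF B] by simp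
  next
    case False
    then consider w where "w \<in> W" "[s = w] (mod n)" | k where "[s = e k] (mod n)"
      using cover by blast
    thus ?thesis
    proof cases
      case (1 w)
      have "conn n A (g ^ i * s) \<longleftrightarrow> conn n A w"
        by (rule conn_cong) (rule cong_trans[OF cong_scalar_left[OF 1(2)] W_fixed[OF 1(1) gi]])
      thus ?thesis using * 1(1) conn_cong[OF 1(2), of B] by blast
    next
      case (2 k)
      have "conn n A (g ^ i * s) \<longleftrightarrow> code A (k + d * i)"
        unfolding code_def e_shift by (rule conn_cong) (rule cong_scalar_left[OF 2])
      thus ?thesis using i[of k] conn_cong[OF 2, of B] by (simp add: code_def)
    qed
  qed
  thus "multiplier_equiv n A B" using gi unfolding multiplier_equiv_def by blast
qed

lemma digraph_iso_iff:
  assumes "circulant n G" "circulant n H"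
  shows "digraph_iso (with_proj G) (with_proj H) \<longleftrightarrow>
    {w\<in>W. conn n (parcs G) w} = {w\<in>W. conn n (parcs H) w} \<and> (code (parcs G), code (parcs H)) \<in> rotation d"
proof -
  have c: "circ_arcs n (parcs G)" "circ_arcs n (parcs H)" using assms by (simp_all add: circulant_iff)
  have "(\<exists>f. arc_iso {..<n} (parcs G) (parcs H) f) \<longleftrightarrow> multiplier_equiv n (parcs G) (parcs H)"
    using multiplier[OF c] multiplier_imp_iso[OF n c(2,1)] multiplier_equiv_sym[OF n] by blast
  thus ?thesis
    unfolding digraph_iso_circulant_iff[OF assms] multiplier_equiv_iff[OF c, symmetric] .
qed

lemma code_surj:
  assumes "U \<subseteq> W" and f: "f \<in> periodic L"
  obtains G where "circulant n G" and "{w\<in>W. conn n (parcs G) w} = U" and "code (parcs G) = f"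
proof -
  define Q where "Q s \<longleftrightarrow> (\<exists>w\<in>U. [s = w] (mod n)) \<or> (\<exists>k. [s = e k] (mod n) \<and> f k)" for s
  have "Q s = Q t" if "[s = t] (mod n)" for s t
    using that unfolding Q_def by (meson cong_sym cong_trans)
  moreover have "\<not> Q 0"
  proof -
    have "\<not> [0 = w] (mod n)" if "w \<in> U" for w
      using that assms(1) W by (auto simp: cong_def subset_iff)
    moreover have "\<not> [0 = e k] (mod n)" for k using not_0[of k] by (auto simp: cong_def dvd_eq_mod_eq_0)
    ultimately show ?thesis by (auto simp: Q_def)
  qed
  ultimately have arcs: "circ_arcs n (arcs_of n Q)" "\<And>s. conn n (arcs_of n Q) s = Q s"
    using circ_arcs_arcs_of[OF n, of Q] by blast+
  define G where "G = \<lparr>pverts = {..<n}, parcs = arcs_of n Q\<rparr>"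
  have "circulant n G" by (simp add: circulant_iff G_def arcs)
  moreover have "Q w \<longleftrightarrow> w \<in> U" if w: "w \<in> W" for w
  proof -
    have "w = u" if "[w = u] (mod n)" "u \<in> U" for u
      using that w W assms(1) by (auto simp: cong_def subset_iff)
    hence "(\<exists>u\<in>U. [w = u] (mod n)) \<longleftrightarrow> w \<in> U" using cong_refl by blast
    moreover have "\<not> [w = e k] (mod n)" for k using not_W[OF w] cong_sym by blast
    ultimately show ?thesis unfolding Q_def by blast
  qed
  hence "{w\<in>W. conn n (parcs G) w} = U" using assms(1) by (auto simp: G_def arcs)
  moreover have "Q (e k) = f k" for k
  proof -
    have "f l = f k" if "[e k = e l] (mod n)" for l
      using periodic_cong[OF f, of l k] iffD1[OF e_cong that] by (simp add: cong_def)
    hence "(\<exists>l. [e k = e l] (mod n) \<and> f l) \<longleftrightarrow> f k" using cong_refl by blast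
    thus ?thesis using not_W assms(1) unfolding Q_def by blast
  qed
  hence "code (parcs G) = f" by (simp add: code_def G_def arcs fun_eq_iff)
  ultimately show ?thesis using that by blast
qed

text \<open>
  A circulant is determined up to isomorphism by the part of its connection set inside \<open>W\<close> and by the
  class of its code under rotation, and every such pair occurs.  Taking \<open>M = L\<close> counts all
  circulants, \<open>M = L / 2\<close> the undirected ones.
\<close>

lemma card_classes:
  assumes "M dvd L" and S: "S = {G. circulant n G \<and> code (parcs G) \<in> periodic M}"
  shows "card (S // iso_rel S) = 2 ^ card W * necklaces d M"
proof -
  have M: "M > 0" using assms(1) L by (metis dvd_pos_nat)
  define R where "R = rotation d \<inter> periodic M \<times> periodic M"
  have R: "equiv (periodic M) R" unfolding R_def by (rule equiv_rotation[OF _ M]) simp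
  define \<phi> where "\<phi> G = ({w\<in>W. conn n (parcs G) w}, R `` {code (parcs G)})"
    for G :: "nat pair_pre_digraph"
  have "card (S // iso_rel S) = card (\<phi> ` S)"
  proof (rule card_quotient_kernel)
    have "digraph_iso (with_proj G) (with_proj H) \<longleftrightarrow> \<phi> G = \<phi> H" if "G \<in> S" "H \<in> S" for G H
    proof -
      have GH: "circulant n G" "circulant n H"
        "code (parcs G) \<in> periodic M" "code (parcs H) \<in> periodic M" using that by (simp_all add: S)
      have "(code (parcs G), code (parcs H)) \<in> rotation d \<longleftrightarrow>
          R `` {code (parcs G)} = R `` {code (parcs H)}"
        using eq_equiv_class_iff[OF R GH(3,4)] GH(3,4) by (simp add: R_def)
      thus ?thesis using digraph_iso_iff[OF GH(1,2)] by (simp add: \<phi>_def)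
    qed
    thus "iso_rel S = {(G, H). G \<in> S \<and> H \<in> S \<and> \<phi> G = \<phi> H}"
      unfolding iso_rel_def by blast
  qed
  also have "\<phi> ` S = Pow W \<times> (periodic M // R)"
  proof
    show "\<phi> ` S \<subseteq> Pow W \<times> (periodic M // R)" by (auto simp: \<phi>_def S intro: quotientI)
    show "Pow W \<times> (periodic M // R) \<subseteq> \<phi> ` S"
    proof
      fix UC assume "UC \<in> Pow W \<times> (periodic M // R)"
      then obtain U f where U: "UC = (U, R `` {f})" "U \<subseteq> W" and f: "f \<in> periodic M"
        by (auto elim!: quotientE)
      obtain G where "circulant n G" "{w\<in>W. conn n (parcs G) w} = U" "code (parcs G) = f"
        using code_surj[OF U(2) periodic_dvd[OF f assms(1)]] by blast
      thus "UC \<in> \<phi> ` S" using f U(1) by (intro image_eqI[of _ _ G]) (simp_all add: \<phi>_def S)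
    qed
  qed
  also have "card \<dots> = 2 ^ card W * necklaces d M"
    using finite_subset[OF W] by (simp add: card_cartesian_product card_Pow necklaces_def R_def)
  finally show ?thesis .
qed

text \<open>
  Symmetry is invariance of the connection set under the unit \<open>-1\<close>, and \<open>e_neg\<close> says that this unit
  shifts the enumeration by half of its period.
\<close>

lemma sym_iff:
  assumes A: "circ_arcs n A"
  shows "sym A \<longleftrightarrow> code A \<in> periodic (L div 2)"
proof -
  have neg: "conn n A (e (k + L div 2)) = conn n A ((n - 1) * e k)" for k
    by (rule conn_cong[OF e_neg])
  have "coprime (n - 1) n" by (rule coprime_diff_one_left_nat[OF n])
  hence w: "conn n A ((n - 1) * w) = conn n A w" if "w \<in> W" for w
    using conn_cong[OF W_fixed[OF that]] by blast
  have "sym A \<longleftrightarrow> (\<forall>s. conn n A s \<longleftrightarrow> conn n A ((n - 1) * s))" by (rule sym_circ_arcs_iff[OF n A])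
  also have "\<dots> \<longleftrightarrow> (\<forall>k. conn n A (e k) \<longleftrightarrow> conn n A ((n - 1) * e k))"
  proof safe
    fix s assume *: "\<forall>k. conn n A (e k) \<longleftrightarrow> conn n A ((n - 1) * e k)"
    have "conn n A s \<longleftrightarrow> conn n A ((n - 1) * s)"
    proof (cases "n dvd s")
      case True
      thus ?thesis using not_conn_0[OF A] by simp
    next
      case False
      then obtain t where t: "[s = t] (mod n)" "t \<in> W \<or> (\<exists>k. t = e k)" using cover by blast
      hence "conn n A t \<longleftrightarrow> conn n A ((n - 1) * t)" using w * by blast
      thus ?thesis using conn_cong[OF t(1)] conn_cong[OF cong_scalar_left[OF t(1)]] by simp
    qed
    thus "conn n A s \<Longrightarrow> conn n A ((n - 1) * s)" "conn n A ((n - 1) * s) \<Longrightarrow> conn n A s" by blast+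
  qed blast+
  also have "\<dots> \<longleftrightarrow> code A \<in> periodic (L div 2)"
    unfolding periodic_def code_def mem_Collect_eq neg by blast
  finally show ?thesis .
qed

theorem C_d_eq: "C_d n = 2 ^ card W * necklaces d L"
  unfolding C_d_def directed_circulants_def
  by (rule card_classes) (simp_all add: code_periodic)

theorem C_u_eq: "C_u n = 2 ^ card W * necklaces d (L div 2)"
  unfolding C_u_def undirected_circulants_def
proof (rule card_classes)
  show "L div 2 dvd L" using L(2) by (metis dvd_div_mult_self dvd_triv_left)
  show "{G. circulant n G \<and> symmetric (with_proj G)} = {G. circulant n G \<and> code (parcs G) \<in> periodic (L div 2)}"
    using sym_iff by (auto simp: symmetric_with_proj_iff circulant_iff)
qed

end

section \<open>Codes from primitive roots\<close>

lemma primroot_power_cong: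
  assumes "residue_primroot n g"
  shows "[g ^ i = g ^ j] (mod n) \<longleftrightarrow> [i = j] (mod totient n)"
  using assms order_divides_expdiff[of n g i j] by (simp add: residue_primroot_def)

lemma primroot_generates:
  assumes "residue_primroot n g" and "n > 1" and "coprime j n"
  shows "\<exists>i. [j = g ^ i] (mod n)"
proof -
  have "j mod n \<noteq> 0"
    using assms(2,3) by (metis coprime_mod_left_iff coprime_0_left_iff nat_dvd_1_iff_1 less_irrefl not_one_less_zero is_unit_gcd_iff)
  hence "j mod n \<in> totatives n" using assms(2,3) by (simp add: totatives_def less_imp_le)
  also have "totatives n = (\<lambda>i. g ^ i mod n) ` {..<totient n}"
    using residue_primroot_is_generator[OF assms(2,1)] by (simp add: bij_betw_def)
  finally show ?thesis by (auto simp: cong_def)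
qed

text \<open>
  If \<open>-1 = g\<^sup>i\<close>, then \<open>2i\<close> is a multiple of the order of \<open>g\<close> but \<open>i\<close> is not, so \<open>i\<close> is an odd multiple
  of half the order.
\<close>

lemma primroot_half_power:
  assumes "residue_primroot n g" and "n > 2"
  shows "[g ^ (totient n div 2) = n - 1] (mod n)"
proof -
  note pow = primroot_power_cong[OF assms(1)]
  have "even (totient n)" using assms(2) by (rule totient_even)
  then obtain t where t: "totient n = 2 * t" by (elim evenE)
  have "coprime (n - 1) n"
    using assms(2) by (intro coprime_diff_one_left_nat) simp
  then obtain i where i: "[n - 1 = g ^ i] (mod n)" using primroot_generates[OF assms(1)] assms(2) by auto
  have "[(n - 1) * (n - 1) = 1] (mod n)"
  proof -
    obtain k where "n = k + 2" using assms(2) by (metis add.commute le_add_diff_inverse less_imp_le)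
    hence "(n - 1) * (n - 1) = 1 + n * k" by (simp add: algebra_simps)
    thus ?thesis by (simp only: cong_def mod_mult_self2)
  qed
  moreover have "[(n - 1) * (n - 1) = g ^ i * g ^ i] (mod n)" using i i by (rule cong_mult)
  ultimately have "[g ^ (i + i) = g ^ 0] (mod n)"
    by (simp only: power_add power_0) (metis cong_sym cong_trans)
  hence "[i + i = 0] (mod 2 * t)" by (simp only: pow t)
  hence "2 * t dvd 2 * i" by (simp add: cong_0_iff mult_2)
  then obtain m where m: "i = t * m" by auto
  have "odd m"
  proof
    assume "even m"
    then obtain u where "m = 2 * u" by (elim evenE)
    hence "[i = 0] (mod totient n)" using m t by (simp add: cong_0_iff)
    hence "[g ^ i = g ^ 0] (mod n)" by (simp only: pow)
    hence "[n - 1 = 1] (mod n)" using i by (simp add: cong_trans)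
    thus False using assms(2) by (simp add: cong_def)
  qed
  then obtain u where "m = 2 * u + 1" by (elim oddE)
  hence "i = t + totient n * u" using m t by (simp add: algebra_simps)
  hence "[t = i] (mod totient n)" by (simp only: cong_def mod_mult_self2)
  hence "[g ^ t = g ^ i] (mod n)" by (simp only: pow)
  hence "[g ^ t = n - 1] (mod n)" using i by (metis cong_sym cong_trans)
  thus ?thesis using t by simp
qed

lemma circulant_coding_prime:
  assumes "prime p" and "odd p" and g: "residue_primroot p g"
  shows "circulant_coding p 1 (p - 1) g {} (\<lambda>k. g ^ k)"
proof -
  have p: "p > 2" using assms(1,2) prime_ge_2_nat[of p] by (cases "p = 2") auto
  have tot: "totient p = p - 1" by (rule totient_prime[OF assms(1)])
  have cop: "coprime g p" using g by (simp add: residue_primroot_def coprime_commute)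
  show ?thesis
  proof
    show "p > 0" "p - 1 > 0" "even (p - 1)" using p assms(2) by simp_all
    show "multiplier_equiv p A B" if "circ_arcs p A" "circ_arcs p B" "arc_iso {..<p} A B f" for A B f
      by (rule multiplier_prime[OF assms(1) that])
    show "\<exists>i. [j = g ^ i] (mod p)" if "coprime j p" for j
      using primroot_generates[OF g _ that] p by simp
    show "g ^ (k + 1 * i) = g ^ i * g ^ k" for k i by (simp add: power_add)
    show "[g ^ k = g ^ l] (mod p) \<longleftrightarrow> [k = l] (mod (p - 1))" for k l
      using primroot_power_cong[OF g] tot by simp
    show "[g ^ (k + (p - 1) div 2) = (p - 1) * g ^ k] (mod p)" for k
      using cong_scalar_right[OF primroot_half_power[OF g p], of "g ^ k"] tot
      by (simp add: power_add mult.commute)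
    show "(\<exists>w\<in>{}. [s = w] (mod p)) \<or> (\<exists>k. [s = g ^ k] (mod p))" if "\<not> p dvd s" for s
      using primroot_generates[OF g, of s] p that assms(1) by (simp add: prime_imp_coprime coprime_commute)
    show "\<not> p dvd g ^ k" for k
      using cop assms(1) p by (metis coprime_absorb_right coprime_power_left_iff less_irrefl numeral_One
          one_less_numeral_iff order_less_trans semiring_norm(76) coprime_common_divisor_nat dvd_refl nat_neq_iff)
  qed (use cop in auto)
qed

text \<open>
  The odd residues other than \<open>q\<close> are the units, that is, the powers of \<open>g\<close>; the nonzero even residues
  are the doubles of units, because every nonzero residue modulo \<open>q\<close> has an odd representative.
\<close>

lemma circulant_coding_twice_prime:
  assumes "prime q" and "odd q" and "n = 2 * q" and g: "residue_primroot n g"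
  shows "circulant_coding n 2 (2 * (q - 1)) g {q} (\<lambda>k. (if even k then 1 else 2) * g ^ (k div 2))"
proof -
  have q: "q > 2" using assms(1,2) prime_ge_2_nat[of q] by (cases "q = 2") auto
  hence n: "n > 2" "n > 1" using assms(3) by simp_all
  have "coprime 2 q" using assms(2) by simp
  hence tot: "totient n = q - 1"
    using totient_mult_coprime[of 2 q] totient_prime[OF assms(1)] assms(3) by simp
  have "coprime g n" using g by (simp add: residue_primroot_def coprime_commute)
  hence cop: "coprime g q" "odd g" using assms(3) by simp_all
  have coprime_n: "coprime j n \<longleftrightarrow> odd j \<and> \<not> q dvd j" for j
    using assms(1,3) by (auto simp: coprime_commute[of j] prime_imp_coprime coprime_absorb_left)
  define e where "e k = (if even k then 1 else 2) * g ^ (k div 2)" for k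
  have shift: "e (k + 2 * i) = g ^ i * e k" for k i by (simp add: e_def power_add)
  have even_e: "even (e k) \<longleftrightarrow> odd k" for k using cop(2) by (simp add: e_def)
  have not_q: "\<not> q dvd e k" for k
  proof
    assume "q dvd e k"
    hence "q dvd 2 \<or> q dvd g" using assms(1) q
      by (auto simp: e_def prime_dvd_mult_iff split: if_splits dest: prime_dvd_power)
    thus False using q cop(1) assms(1) by (auto dest: dvd_imp_le coprime_common_divisor_nat[of g q q])
  qed
  have e_cong: "[e k = e l] (mod n) \<longleftrightarrow> [k = l] (mod (2 * (q - 1)))" for k l
  proof (cases "even k \<longleftrightarrow> even l")
    case False
    have "\<not> [e k = e l] (mod n)"
      using False even_e cong_dvd_iff[OF cong_dvd_modulus_nat, of "e k" "e l" n 2] assms(3) by auto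
    moreover have "\<not> [k = l] (mod (2 * (q - 1)))"
      using False cong_dvd_iff[OF cong_dvd_modulus_nat, of k l "2 * (q - 1)" 2] by auto
    ultimately show ?thesis by blast
  next
    case True
    define a b where "a = k div 2" and "b = l div 2"
    have pow: "[g ^ a = g ^ b] (mod n) \<longleftrightarrow> [a = b] (mod (q - 1))"
      using primroot_power_cong[OF g] tot by simp
    have dbl: "[2 * x = 2 * y] (mod (2 * m)) \<longleftrightarrow> [x = y] (mod m)" for x y m :: nat
      by (simp add: cong_def)
    show ?thesis
    proof (cases "even k")
      case ev: True
      hence "k = 2 * a" "l = 2 * b" using True by (simp_all add: a_def b_def)
      thus ?thesis using pow by (simp add: e_def dbl)
    next
      case od: False
      hence kl: "k = 2 * a + 1" "l = 2 * b + 1" using True by (simp_all add: a_def b_def)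
      have "[e k = e l] (mod n) \<longleftrightarrow> [g ^ a = g ^ b] (mod q)"
        unfolding assms(3) kl by (simp add: e_def dbl)
      also have "\<dots> \<longleftrightarrow> [g ^ a = g ^ b] (mod n)"
      proof
        assume "[g ^ a = g ^ b] (mod q)"
        moreover have "[g ^ a = g ^ b] (mod 2)" using cop(2) by (simp add: cong_def mod_2_eq_odd)
        ultimately show "[g ^ a = g ^ b] (mod n)"
          unfolding assms(3) using \<open>coprime 2 q\<close> coprime_cong_mult_nat by blast
      qed (rule cong_dvd_modulus_nat, assumption, simp add: assms(3))
      finally show ?thesis unfolding pow by (simp only: kl cong_add_rcancel_nat dbl)
    qed
  qed
  have "circulant_coding n 2 (2 * (q - 1)) g {q} e"
  proof
    show "n > 0" "2 * (q - 1) > 0" "even (2 * (q - 1))" using q n by simp_all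
    show "multiplier_equiv n A B" if "circ_arcs n A" "circ_arcs n B" "arc_iso {..<n} A B f" for A B f
      by (rule multiplier_twice_prime[OF assms(1-3) that])
    show "coprime g n" by fact
    show "\<exists>i. [j = g ^ i] (mod n)" if "coprime j n" for j
      by (rule primroot_generates[OF g n(2) that])
    show "e (k + 2 * i) = g ^ i * e k" for k i by (rule shift)
    show "[e k = e l] (mod n) \<longleftrightarrow> [k = l] (mod (2 * (q - 1)))" for k l by (rule e_cong)
    show "[e (k + 2 * (q - 1) div 2) = (n - 1) * e k] (mod n)" for k
    proof -
      have "2 * (q - 1) div 2 = 2 * (totient n div 2)" using tot assms(2) by simp
      thus ?thesis
        using cong_scalar_right[OF primroot_half_power[OF g n(1)], of "e k"] by (simp only: shift)
    qed
    show "{q} \<subseteq> {0<..<n}" using q assms(3) by simp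
    show "[j * w = w] (mod n)" if "w \<in> {q}" "coprime j n" for w j
    proof -
      obtain u where "j = 2 * u + 1" using \<open>coprime j n\<close> coprime_n by (auto elim: oddE)
      hence "j * w = w + n * u" using \<open>w \<in> {q}\<close> assms(3) by simp
      thus ?thesis by (simp add: cong_def)
    qed
    show "\<not> [e k = w] (mod n)" if "w \<in> {q}" for w k
    proof
      assume "[e k = w] (mod n)"
      hence "[e k = w] (mod q)" by (rule cong_dvd_modulus_nat) (simp add: assms(3))
      hence "q dvd e k" using that by (simp add: cong_dvd_iff)
      thus False using not_q by blast
    qed
    show "\<not> n dvd e k" for k using not_q[of k] assms(3) by (auto dest: dvd_mult_right)
    show "(\<exists>w\<in>{q}. [s = w] (mod n)) \<or> (\<exists>k. [s = e k] (mod n))" if s: "\<not> n dvd s" for s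
    proof (cases "odd s")
      case odd: True
      show ?thesis
      proof (cases "q dvd s")
        case True
        then obtain m where m: "s = q * m" by (elim dvdE)
        then obtain u where "m = 2 * u + 1" using odd by (auto elim: oddE)
        hence "s = q + n * u" using m assms(3) by simp
        thus ?thesis by (simp add: cong_def)
      next
        case False
        then obtain i where "[s = g ^ i] (mod n)"
          using primroot_generates[OF g n(2), of s] coprime_n odd by blast
        hence "[s = e (2 * i)] (mod n)" by (simp add: e_def)
        thus ?thesis by blast
      qed
    next
      case False
      then obtain u where u: "s = 2 * u" by auto
      \<comment> \<open>an odd representative of \<open>u\<close> modulo \<open>q\<close>\<close>
      define v where "v = (if odd u then u else u + q)"
      have "\<not> q dvd u" using s u assms(3) by auto
      hence "coprime v n" using assms(2) unfolding coprime_n v_def by simp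
      then obtain i where "[v = g ^ i] (mod n)" using primroot_generates[OF g n(2)] by blast
      hence "[2 * v = 2 * g ^ i] (mod n)" by (rule cong_scalar_left)
      moreover have "[s = 2 * v] (mod n)" using u assms(3) by (simp add: v_def cong_def)
      ultimately have "[s = e (2 * i + 1)] (mod n)" by (simp add: e_def cong_trans)
      thus ?thesis by blast
    qed
  qed
  thus ?thesis unfolding e_def .
qed

section \<open>The identity between the numbers of circulants\<close>

theorem mainTheorem4:
  fixes p :: nat
  assumes "prime p" and "odd p"
    and "prime ((p + 1) div 2)" and "odd ((p + 1) div 2)"
  shows "4 * int (C_d p) - int (C_d (p + 1)) = 4 * int (C_u p) - int (C_u (p + 1))"
proof -
  define q where "q = (p + 1) div 2"
  have q: "prime q" "odd q" "p + 1 = 2 * q" using assms by (simp_all add: q_def)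
  have "q > 2" using q prime_ge_2_nat[of q] by (cases "q = 2") auto
  obtain g where g: "residue_primroot p g" using prime_primitive_root_exists[OF prime_gt_1_nat[OF assms(1)] assms(1)] by blast
  have "2 * q ^ 1 \<in> cyclic_moduli" unfolding cyclic_moduli_def using q by blast
  then obtain h where h: "residue_primroot (p + 1) h"
    using residue_primroot_iff_in_cyclic_moduli[of "p + 1"] q(3) by auto
  interpret P: circulant_coding p 1 "p - 1" g "{}" "\<lambda>k. g ^ k"
    by (rule circulant_coding_prime[OF assms(1,2) g])
  interpret Q: circulant_coding "p + 1" 2 "2 * (q - 1)" h "{q}" "\<lambda>k. (if even k then 1 else 2) * h ^ (k div 2)"
    by (rule circulant_coding_twice_prime[OF q h])
  have "p - 1 = 2 * (q - 1)" using q(3) by simp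
  hence "C_d p = necklaces 1 (2 * (q - 1))" "C_u p = necklaces 1 (q - 1)"
    using P.C_d_eq P.C_u_eq by simp_all
  moreover have "C_d (p + 1) = 2 * necklaces 2 (2 * (q - 1))" "C_u (p + 1) = 2 * necklaces 2 (q - 1)"
    using Q.C_d_eq Q.C_u_eq by simp_all
  moreover have "2 * necklaces 1 (2 * (q - 1)) + necklaces 2 (q - 1)
      = 2 * necklaces 1 (q - 1) + necklaces 2 (2 * (q - 1))"
    by (rule necklaces_double) (use q(2) \<open>q > 2\<close> in auto)
  ultimately show ?thesis by simp
qed

end
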